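(* (1) The functions $\lambda(x)=\sum_{k=0}^{\infty}(2k+1)^{-x}$ and $\varphi_1(x)=\lambda(x)-\lambda(x+1)$ are both strictly decreasing and convex on $(1,\infty)$, with $\lambda((1,\infty))=(1,\infty)$ and $\varphi_1((1,\infty))=(0,\infty)$. Moreover, for each $c\in[C_1,\infty)$, the function $\varphi_2(x)=\lambda(x+c)/\lambda(x)$ is strictly increasing from $[2,\infty)$ onto $[C_2,1)$, where $C_1=[\log(\pi^2/8)]/\log3=0.191166\cdots$ and $C_2=8\lambda(2+c)/\pi^2>8/\pi^2=0.810569\cdots$. (2) The function $\beta(x)=\sum_{k=0}^{\infty}(-1)^k(2k+1)^{-x}$ is strictly increasing from $[1,\infty)$ onto $[\pi/4,1)$, and concave on $[2/\log3,\infty)$. (3) For $x\in[3,\infty)$ let $\varphi_3(x)=5\lambda(x+1)-\lambda(x-1)-4\beta(x+1)$, $\varphi_4(x)=(x-3+1/\log5)\varphi_3(x)$, $\varphi_5(x)=x\varphi_3(x)$ and $\varphi_6(x)=\varphi_5(x+2)-\varphi_5(x)$. Then $\varphi_3$ is strictly increasing and concave from $[3,\infty)$ onto $[\mu_1,0)$; $\varphi_4$ and $\varphi_5$ are both strictly increasing on $[3,\infty)$ with $\varphi_4([3,\infty))=[\mu_2,0)$ and $\varphi_5([3,\infty))=[\mu_3,0)$; and $\varphi_6$ is strictly decreasing from $[3,\infty)$ onto $(0,\mu_4]$, where $\mu_1=\varphi_3(3)=(5\pi^4/96)-4\beta(4)-\pi^2/8=-0.116088\cdots$, $\mu_2=\mu_1/\log5=-0.072129\cdots$,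 $\mu_3=3\mu_1=-0.348265\cdots$ and $\mu_4=\varphi_5(5)-\mu_3=0.337348\cdots$. (4) For integers $n\ge1$, the sequences $\{b_{n+1}\}$ and $\{(n+1)b_{n+1}\}$ are both strictly increasing, while the sequence $\{(n+2)b_{n+2}-(n+1)b_{n+1}\}$ is strictly decreasing, with $\lim_{n\to\infty}nb_n=\lim_{n\to\infty}[(n+1)b_{n+1}-nb_n]=0$. In particular, for integers $n\ge2$, $$-0.027624\cdots=2b_2\leq nb_n<(n+1)b_{n+1}\leq\min\{0,\ nb_n+3b_3-2b_2\},$$ with equality in each of the non-strict inequalities if and only if $n=2$.
   Context: The functions $\lambda(x)$ (for $x>1$) and $\beta(x)$ (for $x\ge1$) are the real-variable functions defined by the series in the claim. For integers $n\ge2$, $b_n=5\lambda(2n+1)-\lambda(2n-1)-4\beta(2n+1)$. *)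

theory Defs
  imports "HOL-Analysis.Analysis"
begin

definition dirichlet_lambda :: "real \<Rightarrow> real" where
  "dirichlet_lambda x = (\<Sum>k. (2 * real k + 1) powr (- x))"

text \<open>For \<open>0 < x \<le> 1\<close> the following series converges only conditionally; \<open>suminf\<close> is the limit of
  the partial sums in the natural order, as intended.\<close>

definition dirichlet_beta :: "real \<Rightarrow> real" where
  "dirichlet_beta x = (\<Sum>k. (-1) ^ k * (2 * real k + 1) powr (- x))"

definition phi1 :: "real \<Rightarrow> real" where
  "phi1 x = dirichlet_lambda x - dirichlet_lambda (x + 1)"

definition phi2 :: "real \<Rightarrow> real \<Rightarrow> real" where
  "phi2 c x = dirichlet_lambda (x + c) / dirichlet_lambda x"

definition phi3 :: "real \<Rightarrow> real" where
  "phi3 x = 5 * dirichlet_lambda (x + 1) - dirichlet_lambda (x - 1) - 4 * dirichlet_beta (x + 1)"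

definition phi4 :: "real \<Rightarrow> real" where
  "phi4 x = (x - 3 + 1 / ln 5) * phi3 x"

definition phi5 :: "real \<Rightarrow> real" where
  "phi5 x = x * phi3 x"

definition phi6 :: "real \<Rightarrow> real" where
  "phi6 x = phi5 (x + 2) - phi5 x"

definition C1 :: real where
  "C1 = ln (pi\<^sup>2 / 8) / ln 3"

definition C2 :: "real \<Rightarrow> real" where
  "C2 c = 8 * dirichlet_lambda (2 + c) / pi\<^sup>2"

definition mu1 :: real where
  "mu1 = phi3 3"

definition mu2 :: real where
  "mu2 = mu1 / ln 5"

definition mu3 :: real where
  "mu3 = 3 * mu1"

definition mu4 :: real where
  "mu4 = phi5 5 - mu3"

text \<open>Only meaningful for \<open>n \<ge> 2\<close>: for \<open>n = 1\<close> the term \<open>dirichlet_lambda 1\<close> is a divergent series,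
  and for \<open>n = 0\<close> so are \<open>dirichlet_lambda 1\<close> and \<open>dirichlet_lambda (-1)\<close>.\<close>

definition bseq :: "nat \<Rightarrow> real" where
  "bseq n = 5 * dirichlet_lambda (2 * real n + 1) - dirichlet_lambda (2 * real n - 1)
         - 4 * dirichlet_beta (2 * real n + 1)"

end

theory Submission
  imports Defs "HOL-Real_Asymp.Real_Asymp"
begin

text \<open>All functions involved are, up to sign and an additive constant, series whose terms are
  monotone and convex, so that every claim can be checked term by term. For \<open>lambda\<close> and \<open>phi1\<close> the
  terms are \<open>m powr (-x)\<close> and \<open>(1 - 1 / m) * m powr (-x)\<close> with odd \<open>m\<close>. For \<open>beta\<close> one pairs
  consecutive terms: \<open>1 - beta x\<close> is the sum of \<open>(4 * k + 3) powr (-x) - (4 * k + 5) powr (-x)\<close>. The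
  combination \<open>phi3\<close> is chosen so that the terms \<open>m = 1\<close> and \<open>m = 3\<close> cancel; what remains is
  \<open>- phi3 x = (\<Sum> m \<ge> 5. a m * m powr (-x))\<close> with \<open>a m > 0\<close>, and multiplication by \<open>x\<close> or
  \<open>x - 3 + 1 / ln 5\<close> preserves monotonicity because \<open>ln m \<ge> ln 5\<close>.
  Monotonicity of \<open>phi2\<close> is Chebyshev's sum inequality, and \<open>lambda 4\<close> comes from the
  fourth-order coefficient of \<open>sin z * sinh z / z\<^sup>2\<close>, compared with its infinite product.
  The sequence \<open>bseq\<close> is \<open>phi3\<close> restricted to even arguments.\<close>

section \<open>Series of real functions\<close>

lemma exp_gt_one_plus_self: "x \<noteq> 0 \<Longrightarrow> 1 + x < exp x" for x :: real
  using exp_minus_greater[of "-x"] by auto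

text \<open>Strictness is asked of one term \<open>j\<close> only, because series such as lambda
  contain a constant term (\<open>m = 1\<close>). The difference of the two sums is then a series of
  nonnegative terms with a positive one.\<close>

lemma strict_antimono_on_suminf:
  fixes g :: "nat \<Rightarrow> real \<Rightarrow> real"
  assumes summ: "\<And>x. x \<in> S \<Longrightarrow> summable (\<lambda>k. g k x)"
    and le: "\<And>k x y. x \<in> S \<Longrightarrow> y \<in> S \<Longrightarrow> x < y \<Longrightarrow> g k y \<le> g k x"
    and less: "\<And>x y. x \<in> S \<Longrightarrow> y \<in> S \<Longrightarrow> x < y \<Longrightarrow> g j y < g j x"
  shows "strict_antimono_on S (\<lambda>x. \<Sum>k. g k x)"
proof (rule monotone_onI)
  fix x y assume "x \<in> S" "y \<in> S" "x < y"
  then have "0 < (\<Sum>k. g k x - g k y)"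
    using le less summ by (intro suminf_pos2[where i = j] summable_diff) auto
  also have "\<dots> = (\<Sum>k. g k x) - (\<Sum>k. g k y)"
    using summ \<open>x \<in> S\<close> \<open>y \<in> S\<close> by (intro suminf_diff[symmetric])
  finally show "(\<Sum>k. g k x) > (\<Sum>k. g k y)" by simp
qed

lemma convex_on_suminf:
  fixes g :: "nat \<Rightarrow> real \<Rightarrow> real"
  assumes "convex S"
    and summ: "\<And>x. x \<in> S \<Longrightarrow> summable (\<lambda>k. g k x)"
    and conv: "\<And>k. convex_on S (g k)"
  shows "convex_on S (\<lambda>x. \<Sum>k. g k x)"
proof (rule convex_onI)
  fix t x y :: real assume t: "0 < t" "t < 1" and xy: "x \<in> S" "y \<in> S"
  then have S: "(1 - t) *\<^sub>R x + t *\<^sub>R y \<in> S"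
    using convexD[OF \<open>convex S\<close>, of x y "1 - t" t] by auto
  have "(\<Sum>k. g k ((1 - t) *\<^sub>R x + t *\<^sub>R y)) \<le> (\<Sum>k. (1 - t) * g k x + t * g k y)"
    using t xy S by (intro suminf_le convex_onD[OF conv] summ summable_add summable_mult) auto
  also have "\<dots> = (1 - t) * (\<Sum>k. g k x) + t * (\<Sum>k. g k y)"
    using xy summ by (simp add: suminf_add[symmetric] suminf_mult summable_mult)
  finally show "(\<Sum>k. g k ((1 - t) *\<^sub>R x + t *\<^sub>R y)) \<le> (1 - t) * (\<Sum>k. g k x) + t * (\<Sum>k. g k y)" .
qed fact

lemma convex_on_eq:
  fixes f :: "'a::real_vector \<Rightarrow> real"
  assumes f: "convex_on S f" and eq: "\<And>x. x \<in> S \<Longrightarrow> f x = g x"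
  shows "convex_on S g"
proof (rule convex_onI)
  show "convex S" using f by (rule convex_on_imp_convex)
  fix t x y assume t: "0 < t" "t < (1::real)" and xy: "x \<in> S" "y \<in> S"
  then have "(1 - t) *\<^sub>R x + t *\<^sub>R y \<in> S"
    using convexD[OF \<open>convex S\<close>, of x y "1 - t" t] by auto
  then show "g ((1 - t) *\<^sub>R x + t *\<^sub>R y) \<le> (1 - t) * g x + t * g y"
    using convex_onD[OF f, of t x y] t xy by (simp add: eq)
qed

text \<open>Weierstrass M-test: the values at the left endpoint \<open>a\<close> serve as the
  summable majorant, so the partial sums converge uniformly on the whole ray.\<close>

lemma continuous_on_suminf_antimono:
  fixes g :: "nat \<Rightarrow> real \<Rightarrow> real"
  assumes cont: "\<And>k. continuous_on {a..} (g k)"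
    and nonneg: "\<And>k x. a \<le> x \<Longrightarrow> 0 \<le> g k x"
    and le: "\<And>k x. a \<le> x \<Longrightarrow> g k x \<le> g k a"
    and summ: "summable (\<lambda>k. g k a)"
  shows "continuous_on {a..} (\<lambda>x. \<Sum>k. g k x)"
proof (rule uniform_limit_theorem[where F = sequentially])
  show "uniform_limit {a..} (\<lambda>n x. \<Sum>k<n. g k x) (\<lambda>x. \<Sum>k. g k x) sequentially"
    using nonneg le by (intro Weierstrass_m_test[OF _ summ]) auto
qed (auto intro!: always_eventually continuous_intros cont)

text \<open>The limit \<open>L\<close> bounds \<open>f\<close> from above and is never attained,
  since \<open>f x < f (x + 1) \<le> L\<close>. Surjectivity is the intermediate value theorem
  between \<open>a\<close> and a point where \<open>f\<close> has already exceeded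
  \<open>y\<close>.\<close>

lemma image_Ici_strict_mono:
  fixes f :: "real \<Rightarrow> real"
  assumes mono: "strict_mono_on {a..} f" and cont: "continuous_on {a..} f"
    and lim: "(f \<longlongrightarrow> L) at_top"
  shows "f ` {a..} = {f a..<L}"
proof (intro equalityI subsetI)
  fix y assume "y \<in> f ` {a..}"
  then obtain x where x: "a \<le> x" "y = f x" by auto
  have "f (x + 1) \<le> L"
  proof (rule tendsto_lowerbound[OF lim])
    show "eventually (\<lambda>z. f (x + 1) \<le> f z) at_top"
      using eventually_gt_at_top[of "x + 1"]
      by eventually_elim (use mono x in \<open>auto intro!: less_imp_le simp: monotone_on_def\<close>)
  qed simp
  moreover have "f x < f (x + 1)" using mono x by (auto simp: monotone_on_def)
  moreover have "f a \<le> f x" using mono x by (cases "a = x") (auto simp: monotone_on_def less_imp_le)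
  ultimately show "y \<in> {f a..<L}" using x by auto
next
  fix y assume y: "y \<in> {f a..<L}"
  then have "eventually (\<lambda>z. y < f z \<and> a \<le> z) at_top"
    by (intro eventually_conj order_tendstoD(1)[OF lim] eventually_ge_at_top) auto
  then obtain z where z: "y < f z" "a \<le> z"
    by (auto dest: eventually_happens)
  have "continuous_on {a..z} f"
    using cont by (rule continuous_on_subset) auto
  then obtain x where "a \<le> x" "x \<le> z" "f x = y"
    using IVT'[of f a y z] y z by auto
  then show "y \<in> f ` {a..}" by auto
qed

text \<open>The previous lemma, applied to \<open>- f\<close> on closed rays \<open>{x..}\<close>,
  gives their images; unboundedness lets these closed rays exhaust all values above
  \<open>L\<close>.\<close>

lemma image_Ioi_strict_antimono:
  fixes f :: "real \<Rightarrow> real"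
  assumes mono: "strict_antimono_on {a<..} f" and cont: "continuous_on {a<..} f"
    and lim: "(f \<longlongrightarrow> L) at_top" and unbounded: "\<And>y. \<exists>x>a. y < f x"
  shows "f ` {a<..} = {L<..}"
proof -
  have image_Ici: "f ` {x..} = {L<..f x}" if "a < x" for x
  proof -
    have "(\<lambda>z. - f z) ` {x..} = {- f x..<-L}"
      using that mono by (intro image_Ici_strict_mono tendsto_minus lim continuous_on_minus continuous_on_subset[OF cont])
        (auto simp: monotone_on_def)
    then have "uminus ` (\<lambda>z. - f z) ` {x..} = uminus ` {- f x..<-L}" by simp
    then show ?thesis by (simp add: image_image)
  qed
  show ?thesis
  proof (intro equalityI subsetI)
    fix y assume "y \<in> {L<..}"
    moreover obtain x where "a < x" "y < f x" using unbounded by blast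
    ultimately have "y \<in> f ` {x..}" using image_Ici by auto
    with \<open>a < x\<close> show "y \<in> f ` {a<..}" by force
  next
    fix y assume "y \<in> f ` {a<..}"
    then obtain x where "a < x" "y = f x" by auto
    with image_Ici[of x] show "y \<in> {L<..}" by auto
  qed
qed

section \<open>Monotonicity and convexity of single exponential terms\<close>

lemma convex_on_powr_minus:
  fixes m :: real
  assumes "0 < m" "convex S"
  shows "convex_on S (\<lambda>x. m powr (-x))"
proof -
  have "convex_on UNIV (\<lambda>x. m powr (-x))"
    using assms by (intro f''_ge0_imp_convex[where f' = "\<lambda>x. - ln m * m powr (-x)" and f'' = "\<lambda>x. (ln m)^2 * m powr (-x)"])
      (auto intro!: derivative_eq_intros simp: power2_eq_square)
  then show ?thesis using assms(2) convex_on_subset by blast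
qed

text \<open>The derivative has the sign of \<open>1 - (x + c) * ln m\<close>, so the last hypothesis
  places \<open>a\<close> at or beyond the critical point. The proof compares two points directly
  through \<open>1 + t < exp t\<close> with \<open>t = (y - x) * ln m\<close>.\<close>

lemma strict_antimono_on_linear_times_powr:
  fixes a c m :: real
  assumes "1 < m" "0 < a + c" "1 \<le> (a + c) * ln m"
  shows "strict_antimono_on {a..} (\<lambda>x. (x + c) * m powr (-x))"
proof (rule monotone_onI)
  fix x y :: real assume xy: "x \<in> {a..}" "y \<in> {a..}" "x < y"
  from assms have L: "0 < ln m" by simp
  have "(a + c) * ln m \<le> (x + c) * ln m"
    using xy L by (intro mult_right_mono) auto
  then have "1 \<le> (x + c) * ln m" using assms by linarith
  then have "(y - x) * 1 \<le> (y - x) * ((x + c) * ln m)"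
    using xy by (intro mult_left_mono) auto
  then have "y + c \<le> (x + c) * (1 + (y - x) * ln m)" by (simp add: algebra_simps)
  also have "\<dots> < (x + c) * exp ((y - x) * ln m)"
    using xy assms L exp_gt_one_plus_self[of "(y - x) * ln m"]
    by (intro mult_strict_left_mono) auto
  also have "exp ((y - x) * ln m) = m powr (y - x)"
    using assms by (simp add: powr_def)
  finally have "(y + c) * m powr (-y) < ((x + c) * m powr (y - x)) * m powr (-y)"
    using assms by (intro mult_strict_right_mono) auto
  also have "\<dots> = (x + c) * m powr (-x)"
    by (simp add: mult.assoc flip: powr_add)
  finally show "(x + c) * m powr (-x) > (y + c) * m powr (-y)" .
qed

text \<open>The derivative of \<open>x * m powr (-x)\<close> is \<open>(1 - u) * exp (-u)\<close> with \<open>u = x * ln m\<close>, and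
  \<open>(1 - u) * exp (-u)\<close> increases strictly for \<open>u \<ge> 2\<close>.\<close>

lemma strict_antimono_on_diff_times_powr:
  fixes a m :: real
  assumes "1 < m" "2 \<le> a * ln m" "0 < h"
  shows "strict_antimono_on {a..} (\<lambda>x. x * m powr (-x) - (x + h) * m powr (-(x + h)))"
proof (rule monotone_onI)
  let ?f = "\<lambda>x. x * m powr (-x) - (x + h) * m powr (-(x + h))"
  have key: "(v - 1) * exp (-v) < (u - 1) * exp (-u)" if "2 \<le> u" "u < v" for u v :: real
  proof -
    \<comment> \<open>This product is exactly \<open>(u - 1) * (1 + (v - u)) - (v - 1)\<close>,
      which is where the threshold 2 enters.\<close>
    have "0 \<le> (u - 2) * (v - u)" using that by simp
    then have "v - 1 \<le> (u - 1) * (1 + (v - u))" by (simp add: algebra_simps)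
    also have "\<dots> < (u - 1) * exp (v - u)"
      using that exp_gt_one_plus_self[of "v - u"] by (intro mult_strict_left_mono) auto
    finally have "(v - 1) * exp (-v) < (u - 1) * exp (v - u) * exp (-v)" by simp
    then show ?thesis by (simp add: mult.assoc flip: exp_add)
  qed
  fix x y :: real assume "x \<in> {a..}" "y \<in> {a..}" and xy: "x < y"
  show "?f x > ?f y"
  proof (rule DERIV_neg_imp_decreasing[of x y ?f], goal_cases)
    case (2 z)
    note z = this
    from assms have L: "0 < ln m" by simp
    have deriv: "(?f has_field_derivative
        (m powr (-z) - z * (ln m * m powr (-z))) - (m powr (-(z + h)) - (z + h) * (ln m * m powr (-(z + h))))) (at z)"
      using assms by (auto intro!: derivative_eq_intros simp: algebra_simps minus_diff_commute[of h z])
    have "a * ln m \<le> z * ln m"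
      using L \<open>x \<in> {a..}\<close> z by (intro mult_right_mono) auto
    then have "((z + h) * ln m - 1) * exp (- ((z + h) * ln m)) < (z * ln m - 1) * exp (- (z * ln m))"
      using L assms(2,3) by (intro key) (linarith, simp)
    then have neg: "(m powr (-z) - z * (ln m * m powr (-z))) - (m powr (-(z + h)) - (z + h) * (ln m * m powr (-(z + h)))) < 0"
      using assms by (simp add: powr_def algebra_simps)
    from deriv neg show ?case by blast
  qed (fact xy)
qed

text \<open>The derivative at \<open>z\<close> is negative because \<open>ln t * t powr (-z)\<close>
  decreases in \<open>t\<close> once \<open>z * ln t \<ge> 1\<close>; this holds from
  \<open>t = m\<close> on, as \<open>z \<ge> 1\<close> and \<open>ln m \<ge> 1\<close>.\<close>

lemma strict_antimono_on_powr_minus_diff: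
  fixes m n :: real
  assumes "1 < m" "m < n" "ln m \<ge> 1"
  shows "strict_antimono_on {1..} (\<lambda>x. m powr (-x) - n powr (-x))"
proof (rule monotone_onI)
  let ?f = "\<lambda>x. m powr (-x) - n powr (-x)"
  fix x y :: real assume "x \<in> {1..}" "y \<in> {1..}" and xy: "x < y"
  show "?f x > ?f y"
  proof (rule DERIV_neg_imp_decreasing[of x y ?f], goal_cases)
    case (2 z)
    note z = this
    then have "1 \<le> z" using \<open>x \<in> {1..}\<close> by auto
    have L: "0 < ln m" "ln m < ln n" using assms by auto
    have deriv: "(?f has_field_derivative - ln m * m powr (-z) + ln n * n powr (-z)) (at z)"
      using assms by (auto intro!: derivative_eq_intros)
    \<comment> \<open>The difference of the two sides factors as
      \<open>(ln m - 1) * (ln n - ln m)\<close>.\<close>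
    have "ln n \<le> ln m * (1 + (ln n - ln m))"
      using mult_nonneg_nonneg[of "ln m - 1" "ln n - ln m"] L assms by (simp add: algebra_simps)
    also have "\<dots> \<le> ln m * (1 + z * (ln n - ln m))"
      using L \<open>1 \<le> z\<close> mult_right_mono[of 1 z "ln n - ln m"] by (intro mult_left_mono) auto
    also have "\<dots> < ln m * exp (z * (ln n - ln m))"
      using L \<open>1 \<le> z\<close> exp_gt_one_plus_self[of "z * (ln n - ln m)"] by (intro mult_strict_left_mono) auto
    finally have "ln n * exp (- (z * ln n)) < ln m * exp (z * (ln n - ln m)) * exp (- (z * ln n))"
      by simp
    also have "\<dots> = ln m * exp (- (z * ln m))"
      by (simp add: mult.assoc algebra_simps flip: exp_add)
    finally have neg: "- ln m * m powr (-z) + ln n * n powr (-z) < 0"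
      using assms by (simp add: powr_def)
    from deriv neg show ?case by blast
  qed (fact xy)
qed

text \<open>The second derivative is nonnegative because \<open>(ln t)^2 * t powr (-z)\<close>
  decreases in \<open>t\<close> once \<open>z * ln t \<ge> 2\<close>. With the smallest base 3 this
  is the source of the threshold \<open>2 / ln 3\<close> for beta.\<close>

lemma convex_on_powr_minus_diff:
  fixes m n :: real
  assumes "1 < m" "m < n" "2 \<le> a * ln m"
  shows "convex_on {a..} (\<lambda>x. m powr (-x) - n powr (-x))"
proof (rule f''_ge0_imp_convex)
  fix z assume z: "z \<in> {a..}"
  have L: "0 < ln m" "ln m < ln n" using assms by auto
  have "0 < a * ln m" using assms by linarith
  then have "0 < a" using L by (simp add: zero_less_mult_iff)
  show "((\<lambda>x. m powr (-x) - n powr (-x)) has_field_derivative ln n * n powr (-z) - ln m * m powr (-z)) (at z)"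
    using assms by (auto intro!: derivative_eq_intros)
  show "((\<lambda>x. ln n * n powr (-x) - ln m * m powr (-x)) has_field_derivative
      (ln m)\<^sup>2 * m powr (-z) - (ln n)\<^sup>2 * n powr (-z)) (at z)"
    using assms by (auto intro!: derivative_eq_intros simp: power2_eq_square)
  \<comment> \<open>Half of the exponent: the bound \<open>ln n \<le> ln m * exp d\<close> squares
    to the inequality required.\<close>
  define d where "d = z * (ln n - ln m) / 2"
  have "a * ln m \<le> z * ln m" using L z by (intro mult_right_mono) auto
  then have "2 \<le> z * ln m" using assms by linarith
  then have "(ln n - ln m) * 2 \<le> (ln n - ln m) * (z * ln m)"
    using L by (intro mult_left_mono) auto
  then have "ln n \<le> ln m * (1 + d)"
    unfolding d_def by (simp add: field_simps)
  also have "\<dots> \<le> ln m * exp d"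
    using L by (intro mult_left_mono exp_ge_add_one_self) auto
  finally have "(ln n)\<^sup>2 \<le> (ln m * exp d)\<^sup>2"
    using L by (intro power_mono) auto
  also have "\<dots> = (ln m)\<^sup>2 * exp (z * (ln n - ln m))"
    unfolding d_def by (simp add: power_mult_distrib flip: exp_double)
  finally have "(ln n)\<^sup>2 * exp (- (z * ln n)) \<le> (ln m)\<^sup>2 * exp (z * (ln n - ln m)) * exp (- (z * ln n))"
    by simp
  also have "\<dots> = (ln m)\<^sup>2 * exp (- (z * ln m))"
    by (simp add: mult.assoc algebra_simps flip: exp_add)
  finally show "(ln m)\<^sup>2 * m powr (-z) - (ln n)\<^sup>2 * n powr (-z) \<ge> 0"
    using assms by (simp add: powr_def)
qed simp

text \<open>Continuity is local, and every point of the open ray is interior to some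
  \<open>{b..}\<close> with \<open>a < b\<close>. On such closed rays the majorant at
  \<open>b\<close> is available even when the series diverges at \<open>a\<close>.\<close>

lemma continuous_on_Ioi_if_Ici:
  fixes f :: "real \<Rightarrow> real"
  assumes "\<And>b. a < b \<Longrightarrow> continuous_on {b..} f"
  shows "continuous_on {a<..} f"
proof (rule continuous_at_imp_continuous_on, rule ballI)
  fix x assume "x \<in> {a<..}"
  then obtain b where "a < b" "b < x" using dense by auto
  have "x \<in> interior {b..}" using \<open>b < x\<close> by simp
  with continuous_on_interior assms[OF \<open>a < b\<close>] show "isCont f x" by blast
qed

section \<open>The function lambda\<close>

text \<open>Raising the exponent from \<open>w\<close> to \<open>x\<close> shrinks each term by at
  least the factor \<open>b powr (w - x)\<close>. It is applied with \<open>b = 3\<close> to the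
  tail of lambda and with \<open>b = 5\<close> to \<open>phi3\<close>.\<close>

lemma dirichlet_series_decay:
  fixes a m :: "nat \<Rightarrow> real"
  assumes "\<And>k. 0 \<le> a k" and "0 < b" "\<And>k. b \<le> m k"
    and summ: "summable (\<lambda>k. a k * m k powr (-w))" and "w \<le> x"
  shows "(\<Sum>k. a k * m k powr (-x)) \<le> b powr (w - x) * (\<Sum>k. a k * m k powr (-w))"
proof -
  have le: "a k * m k powr (-x) \<le> b powr (w - x) * (a k * m k powr (-w))" for k
  proof -
    have "m k powr (-x) = m k powr (w - x) * m k powr (-w)"
      by (simp flip: powr_add)
    also have "\<dots> \<le> b powr (w - x) * m k powr (-w)"
      using assms by (intro mult_right_mono powr_mono2') auto
    finally show ?thesis using assms(1)[of k] by (simp add: mult.left_commute mult_left_mono)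
  qed
  have *: "summable (\<lambda>k. a k * m k powr (-x))"
    by (rule summable_comparison_test'[OF summable_mult[OF summ], where N = 0]) (use le assms(1) in auto)
  show "(\<Sum>k. a k * m k powr (-x)) \<le> b powr (w - x) * (\<Sum>k. a k * m k powr (-w))"
    unfolding suminf_mult[OF summ, symmetric]
    by (intro suminf_le le * summable_mult summ)
qed

lemma dirichlet_lambda_sums:
  assumes "1 < x"
  shows "(\<lambda>k. (2 * real k + 1) powr (-x)) sums dirichlet_lambda x"
proof -
  have "summable (\<lambda>k. real (k + 1) powr (-x))"
    using summable_ignore_initial_segment[of "\<lambda>k. real k powr (-x)" 1] assms
    by (simp add: summable_real_powr_iff)
  then have "summable (\<lambda>k. (2 * real k + 1) powr (-x))"
    by (rule summable_comparison_test'[where N = 0]) (use assms in \<open>auto intro!: powr_mono2'\<close>)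
  then show ?thesis by (simp add: dirichlet_lambda_def summable_sums)
qed

lemmas summable_dirichlet_lambda = dirichlet_lambda_sums[THEN sums_summable]

lemma powr_minus_strict_antimono:
  fixes m :: real
  assumes "1 < m" "x < y"
  shows "m powr (-y) < m powr (-x)"
  using assms by simp

lemma powr_minus_antimono:
  fixes m :: real
  assumes "1 \<le> m" "x \<le> y"
  shows "m powr (-y) \<le> m powr (-x)"
  using assms by (intro powr_mono) auto

lemma strict_antimono_on_dirichlet_lambda: "strict_antimono_on {1<..} dirichlet_lambda"
proof -
  have "strict_antimono_on {1<..} (\<lambda>x. \<Sum>k. (2 * real k + 1) powr (-x))"
    \<comment> \<open>The term \<open>k = 0\<close> is constantly 1, so strictness comes from
      \<open>k = 1\<close>, that is from base 3.\<close>
    by (rule strict_antimono_on_suminf[where j = 1])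
       (auto intro!: summable_dirichlet_lambda powr_minus_antimono powr_minus_strict_antimono)
  then show ?thesis by (simp add: dirichlet_lambda_def[abs_def])
qed

lemma convex_on_dirichlet_lambda: "convex_on {1<..} dirichlet_lambda"
proof -
  have "convex_on {1<..} (\<lambda>x. \<Sum>k. (2 * real k + 1) powr (-x))"
    by (intro convex_on_suminf summable_dirichlet_lambda convex_on_powr_minus) auto
  then show ?thesis by (simp add: dirichlet_lambda_def[abs_def])
qed

lemma continuous_on_dirichlet_lambda: "continuous_on {1<..} dirichlet_lambda"
proof (rule continuous_on_Ioi_if_Ici)
  fix b :: real assume "1 < b"
  then have "continuous_on {b..} (\<lambda>x. \<Sum>k. (2 * real k + 1) powr (-x))"
    by (intro continuous_on_suminf_antimono summable_dirichlet_lambda)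
       (auto intro!: continuous_intros powr_minus_antimono)
  then show "continuous_on {b..} dirichlet_lambda" by (simp add: dirichlet_lambda_def[abs_def])
qed

lemma dirichlet_lambda_gt_1:
  assumes "1 < x"
  shows "1 < dirichlet_lambda x"
proof -
  have "(\<lambda>k. (2 * real (k + 1) + 1) powr (-x)) sums (dirichlet_lambda x - 1)"
    using sums_split_initial_segment[OF dirichlet_lambda_sums[OF assms], of 1] by simp
  then have "dirichlet_lambda x - 1 = (\<Sum>k. (2 * real (k + 1) + 1) powr (-x))"
      and "summable (\<lambda>k. (2 * real (k + 1) + 1) powr (-x))" by (auto simp: sums_iff)
  then show ?thesis
    using suminf_pos[of "\<lambda>k. (2 * real (k + 1) + 1) powr (-x)"] by simp
qed

lemma dirichlet_lambda_tendsto: "(dirichlet_lambda \<longlongrightarrow> 1) at_top"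
proof (rule tendsto_sandwich)
  \<comment> \<open>The factor 1 plays the part of the coefficients in
    \<open>dirichlet_series_decay\<close>.\<close>
  let ?tail = "\<lambda>x. \<Sum>k. 1 * (2 * real (k + 1) + 1) powr (-x)"
  have tail: "(\<lambda>k. 1 * (2 * real (k + 1) + 1) powr (-x)) sums (dirichlet_lambda x - 1)" if "1 < x" for x
    using sums_split_initial_segment[OF dirichlet_lambda_sums[OF that], of 1] by simp
  show "eventually (\<lambda>x. 1 \<le> dirichlet_lambda x) at_top"
    using eventually_gt_at_top[of 1] by eventually_elim (use dirichlet_lambda_gt_1 in force)
  show "eventually (\<lambda>x. dirichlet_lambda x \<le> 1 + 3 powr (2 - x) * ?tail 2) at_top"
    using eventually_gt_at_top[of 2]
  proof eventually_elim
    case (elim x)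
    then have "dirichlet_lambda x - 1 = ?tail x" using tail[of x] by (simp add: sums_iff)
    also have "\<dots> \<le> 3 powr (2 - x) * ?tail 2"
      using elim tail[of 2] by (intro dirichlet_series_decay) (auto simp: sums_iff)
    finally show ?case by simp
  qed
  have "((\<lambda>x::real. 3 powr (2 - x)) \<longlongrightarrow> 0) at_top" by real_asymp
  from tendsto_add[OF tendsto_const[of 1] tendsto_mult_right[OF this]]
  show "((\<lambda>x. 1 + 3 powr (2 - x) * ?tail 2) \<longlongrightarrow> 1) at_top" by simp
qed simp

text \<open>The sum of reciprocals of the odd numbers diverges, so some finite partial sum at
  \<open>x = 1\<close> exceeds \<open>y\<close>. Finite sums are continuous in \<open>x\<close>,
  hence the same partial sum still exceeds \<open>y\<close> slightly to the right of 1, and lambda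
  dominates it there.\<close>

lemma dirichlet_lambda_unbounded: "\<exists>x>1. y < dirichlet_lambda x"
proof -
  have "\<not> summable (\<lambda>k. 1 / (2 * real k + 1))"
  proof
    assume "summable (\<lambda>k. 1 / (2 * real k + 1))"
    from summable_mult[OF this, of 2] have "summable (\<lambda>k. 2 * (1 / (2 * real k + 1)))" .
    then have "summable (\<lambda>k. inverse (real (k + 1)))"
      by (rule summable_comparison_test'[where N = 0]) (simp add: field_simps)
    then have "summable (\<lambda>k. inverse (real k))"
      using summable_iff_shift[of "\<lambda>k. inverse (real k)" 1] by blast
    then show False using not_summable_harmonic[where 'a = real] by blast
  qed
  then have "\<exists>N. y < (\<Sum>k<N. 1 / (2 * real k + 1))"
    using bounded_imp_summable[of "\<lambda>k. 1 / (2 * real k + 1)" y]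
    by (metis (no_types, lifting) divide_nonneg_nonneg lessThan_Suc_atMost not_le
        add_nonneg_nonneg mult_nonneg_nonneg of_nat_0_le_iff zero_le_numeral zero_le_one)
  then obtain N where N: "y < (\<Sum>k<N. 1 / (2 * real k + 1))" by blast
  have "((\<lambda>x. \<Sum>k<N. (2 * real k + 1) powr (-x)) \<longlongrightarrow> (\<Sum>k<N. (2 * real k + 1) powr (-1))) (at_right 1)"
    by (intro tendsto_intros) auto
  then have "eventually (\<lambda>x. y < (\<Sum>k<N. (2 * real k + 1) powr (-x))) (at_right 1)"
    by (rule order_tendstoD(1)) (use N in \<open>simp add: powr_minus_divide\<close>)
  moreover have "eventually (\<lambda>x::real. x \<in> {1<..<2}) (at_right 1)"
    by (rule eventually_at_right_real) simp
  ultimately have "eventually (\<lambda>x. 1 < x \<and> y < dirichlet_lambda x) (at_right 1)"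
  proof eventually_elim
    case (elim x)
    have "(\<Sum>k<N. (2 * real k + 1) powr (-x)) \<le> dirichlet_lambda x"
      using elim dirichlet_lambda_sums[of x]
        sum_le_suminf[of "\<lambda>k. (2 * real k + 1) powr (-x)" "{..<N}"] by (simp add: sums_iff)
    then show ?case using elim by auto
  qed
  then show ?thesis by (auto dest: eventually_happens)
qed

section \<open>The difference \<open>phi1\<close>\<close>

lemma phi1_sums:
  assumes "1 < x"
  shows "(\<lambda>k. (1 - 1 / (2 * real k + 1)) * (2 * real k + 1) powr (-x)) sums phi1 x"
proof -
  have "(2 * real k + 1) powr (-x) - (2 * real k + 1) powr (-(x + 1))
      = (1 - 1 / (2 * real k + 1)) * (2 * real k + 1) powr (-x)" for k
    by (simp add: powr_diff left_diff_distrib)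
  then show ?thesis
    using sums_diff[OF dirichlet_lambda_sums[of x] dirichlet_lambda_sums[of "x + 1"]] assms
    by (simp add: phi1_def)
qed

lemma strict_antimono_on_phi1: "strict_antimono_on {1<..} phi1"
proof -
  have "strict_antimono_on {1<..} (\<lambda>x. \<Sum>k. (1 - 1 / (2 * real k + 1)) * (2 * real k + 1) powr (-x))"
  \<comment> \<open>The coefficient \<open>1 - 1 / m\<close> vanishes at \<open>m = 1\<close>, so
    the first strictly decreasing term is \<open>k = 1\<close>.\<close>
  proof (rule strict_antimono_on_suminf[where j = 1])
    fix x y :: real assume "x < y"
    then show "(1 - 1 / (2 * real 1 + 1)) * (2 * real 1 + 1) powr (-y) < (1 - 1 / (2 * real 1 + 1)) * (2 * real 1 + 1) powr (-x)"
      by (intro mult_strict_left_mono powr_minus_strict_antimono) auto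
  next
    fix k and x y :: real assume "x < y"
    then show "(1 - 1 / (2 * real k + 1)) * (2 * real k + 1) powr (-y) \<le> (1 - 1 / (2 * real k + 1)) * (2 * real k + 1) powr (-x)"
      by (intro mult_left_mono powr_minus_antimono) auto
  qed (intro sums_summable[OF phi1_sums], simp)
  then show ?thesis using phi1_sums by (auto simp: monotone_on_def sums_iff)
qed

lemma convex_on_phi1: "convex_on {1<..} phi1"
proof -
  have "convex_on {1<..} (\<lambda>x. \<Sum>k. (1 - 1 / (2 * real k + 1)) * (2 * real k + 1) powr (-x))"
    by (rule convex_on_suminf, simp, rule sums_summable[OF phi1_sums], simp)
      (intro convex_on_cmul convex_on_powr_minus, auto)
  moreover have "\<And>x. x \<in> {1<..} \<Longrightarrow> (\<Sum>k. (1 - 1 / (2 * real k + 1)) * (2 * real k + 1) powr (-x)) = phi1 x"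
    using phi1_sums by (auto simp: sums_iff)
  ultimately show ?thesis by (rule convex_on_eq)
qed

lemma phi1_image: "phi1 ` {1<..} = {0<..}"
proof (rule image_Ioi_strict_antimono[OF strict_antimono_on_phi1])
  have "continuous_on {1<..} (\<lambda>x. dirichlet_lambda (x + 1))"
    by (rule continuous_on_compose2[OF continuous_on_dirichlet_lambda]) (auto intro!: continuous_intros)
  then show "continuous_on {1<..} phi1"
    unfolding phi1_def[abs_def] by (intro continuous_intros continuous_on_dirichlet_lambda)
  have "((\<lambda>x. dirichlet_lambda (x + 1)) \<longlongrightarrow> 1) at_top"
    by (rule filterlim_compose[OF dirichlet_lambda_tendsto]) real_asymp
  from tendsto_diff[OF dirichlet_lambda_tendsto this]
  show "(phi1 \<longlongrightarrow> 0) at_top" by (simp add: phi1_def[abs_def])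
  fix y
  obtain x where x: "1 < x" "y + dirichlet_lambda 2 < dirichlet_lambda x"
    using dirichlet_lambda_unbounded by blast
  moreover have "dirichlet_lambda (x + 1) < dirichlet_lambda 2"
    using x strict_antimono_on_dirichlet_lambda by (auto simp: monotone_on_def)
  ultimately show "\<exists>x>1. y < phi1 x" by (auto simp: phi1_def)
qed

text \<open>With \<open>F = dirichlet_lambda (x + c) / dirichlet_lambda x = s powr (-c)\<close>, every term of
  \<open>\<Sum> m. m powr (-x) * (m powr (-c) - s powr (-c)) * (m powr (-d) - s powr (-d))\<close> is nonnegative
  (Chebyshev's sum inequality around the mean \<open>F\<close>).\<close>

lemma strict_mono_on_phi2:
  assumes "0 < c"
  shows "strict_mono_on {1<..} (phi2 c)"
proof (rule monotone_onI)
  fix x y :: real assume "x \<in> {1<..}" "y \<in> {1<..}" "x < y"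
  then have "1 < x" by simp
  define d where "d = y - x"
  have "0 < d" "y = x + d" using \<open>x < y\<close> by (auto simp: d_def)
  define F where "F = phi2 c x"
  have pos: "0 < dirichlet_lambda z" if "1 < z" for z
    using dirichlet_lambda_gt_1[OF that] by simp
  have F: "0 < F" "F < 1" "F * dirichlet_lambda x = dirichlet_lambda (x + c)"
    using pos[of x] pos[of "x + c"] assms strict_antimono_on_dirichlet_lambda \<open>1 < x\<close>
    by (auto simp: F_def phi2_def monotone_on_def)
  \<comment> \<open>\<open>s\<close> is the base at which \<open>m powr (-c)\<close> crosses
    \<open>F\<close>; with \<open>G = s powr (-d)\<close> the other factor changes sign at the same
    base, so the two factors never have opposite signs. As \<open>F < 1\<close>, the base 1 lies
    strictly below \<open>s\<close>.\<close>
  define s where "s = F powr (-1/c)"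
  have s: "s powr (-c) = F" "0 < s"
    using F assms by (auto simp: s_def powr_powr)
  have "1 < s" unfolding s_def using F assms powr_less_cancel_iff[of "1/F" 0 "1/c"] by (simp add: powr_divide powr_minus_divide)
  define G where "G = s powr (-d)"
  let ?t = "\<lambda>k. (2 * real k + 1) powr (-x) * (((2 * real k + 1) powr (-c) - F) * ((2 * real k + 1) powr (-d) - G))"
  have "?t = (\<lambda>k. (2 * real k + 1) powr (-(y + c)) - F * (2 * real k + 1) powr (-y)
      - G * ((2 * real k + 1) powr (-(x + c)) - F * (2 * real k + 1) powr (-x)))"
  proof
    fix k
    have "(2 * real k + 1) powr (-y) = (2 * real k + 1) powr (-x) * (2 * real k + 1) powr (-d)"
      "(2 * real k + 1) powr (-(x + c)) = (2 * real k + 1) powr (-x) * (2 * real k + 1) powr (-c)"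
      "(2 * real k + 1) powr (-(y + c))
        = (2 * real k + 1) powr (-x) * (2 * real k + 1) powr (-c) * (2 * real k + 1) powr (-d)"
      unfolding \<open>y = x + d\<close> by (simp_all add: algebra_simps flip: powr_add)
    then show "?t k = (2 * real k + 1) powr (-(y + c)) - F * (2 * real k + 1) powr (-y)
      - G * ((2 * real k + 1) powr (-(x + c)) - F * (2 * real k + 1) powr (-x))"
      by (simp only:) (simp add: algebra_simps)
  qed
  moreover have "\<dots> sums (dirichlet_lambda (y + c) - F * dirichlet_lambda y
      - G * (dirichlet_lambda (x + c) - F * dirichlet_lambda x))"
    using assms \<open>1 < x\<close> \<open>x < y\<close> by (intro sums_diff sums_mult dirichlet_lambda_sums) auto
  \<comment> \<open>The part multiplied by \<open>G\<close> vanishes by the choice of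
    \<open>F\<close>.\<close>
  ultimately have sums: "?t sums (dirichlet_lambda (y + c) - F * dirichlet_lambda y)"
    using F by simp
  have "0 \<le> ?t k" for k
  proof (cases "2 * real k + 1 \<le> s")
    case True
    then have "F \<le> (2 * real k + 1) powr (-c)" "G \<le> (2 * real k + 1) powr (-d)"
      unfolding G_def s(1)[symmetric] using assms \<open>0 < d\<close> by (auto intro!: powr_mono2')
    then show ?thesis by simp
  next
    case False
    then have "(2 * real k + 1) powr (-c) \<le> F" "(2 * real k + 1) powr (-d) \<le> G"
      unfolding G_def s(1)[symmetric] using assms \<open>0 < d\<close> s by (auto intro!: powr_mono2')
    then show ?thesis by (simp add: mult_nonpos_nonpos)
  qed
  moreover have "0 < ?t 0"
    using F \<open>1 < s\<close> \<open>0 < d\<close> powr_minus_strict_antimono[of s 0 d] by (simp add: G_def)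
  ultimately have "0 < dirichlet_lambda (y + c) - F * dirichlet_lambda y"
    using suminf_pos2[of ?t 0] sums by (simp add: sums_iff)
  then have "F < phi2 c y"
    using pos[of y] \<open>y \<in> {1<..}\<close> by (simp add: phi2_def field_simps)
  then show "phi2 c x < phi2 c y" by (simp add: F_def)
qed

lemma phi2_image:
  assumes "0 < c" "1 < a"
  shows "phi2 c ` {a..} = {phi2 c a..<1}"
proof (rule image_Ici_strict_mono)
  show "strict_mono_on {a..} (phi2 c)"
    using strict_mono_on_phi2[OF \<open>0 < c\<close>] assms by (auto simp: monotone_on_def)
  have "continuous_on {a..} (\<lambda>x. dirichlet_lambda (x + c))"
    using assms by (intro continuous_on_compose2[OF continuous_on_dirichlet_lambda]) (auto intro!: continuous_intros)
  moreover have "continuous_on {a..} dirichlet_lambda"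
    by (rule continuous_on_subset[OF continuous_on_dirichlet_lambda]) (use assms in auto)
  moreover have "\<forall>x\<in>{a..}. dirichlet_lambda x \<noteq> 0"
    using dirichlet_lambda_gt_1 assms by (metis atLeast_iff less_le_trans not_one_less_zero)
  ultimately show "continuous_on {a..} (phi2 c)"
    unfolding phi2_def[abs_def] by (intro continuous_on_divide)
  have "((\<lambda>x. dirichlet_lambda (x + c)) \<longlongrightarrow> 1) at_top"
    by (rule filterlim_compose[OF dirichlet_lambda_tendsto]) real_asymp
  from tendsto_divide[OF this dirichlet_lambda_tendsto]
  show "(phi2 c \<longlongrightarrow> 1) at_top" by (simp add: phi2_def[abs_def])
qed

section \<open>The function beta\<close>

lemma dirichlet_beta_terms:
  assumes "0 < x"
  shows "(\<lambda>k. (2 * real k + 1) powr (-x)) \<longlonglongrightarrow> 0" "monoseq (\<lambda>k. (2 * real k + 1) powr (-x))"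
proof -
  show "(\<lambda>k. (2 * real k + 1) powr (-x)) \<longlonglongrightarrow> 0"
    using assms by real_asymp
  show "monoseq (\<lambda>k. (2 * real k + 1) powr (-x))"
    unfolding monoseq_def using assms by (auto intro!: powr_mono2')
qed

lemma dirichlet_beta_sums:
  assumes "0 < x"
  shows "(\<lambda>k. (-1) ^ k * (2 * real k + 1) powr (-x)) sums dirichlet_beta x"
  using summable_Leibniz(1)[OF dirichlet_beta_terms[OF assms]]
  by (simp add: dirichlet_beta_def summable_sums)

lemma dirichlet_beta_in_Leibniz_interval:
  assumes "0 < x"
  shows "dirichlet_beta x \<in> {\<Sum>k<2 * n. (-1) ^ k * (2 * real k + 1) powr (-x)
           .. \<Sum>k<2 * n + 1. (-1) ^ k * (2 * real k + 1) powr (-x)}"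
  using summable_Leibniz(2)[OF dirichlet_beta_terms[OF assms]] by (simp add: dirichlet_beta_def)

text \<open>Drop the leading 1, group in pairs and change sign. Grouping is legitimate for
  conditional convergence as well, because the grouped partial sums are a subsequence of the
  original ones.\<close>

lemma one_minus_dirichlet_beta_sums:
  assumes "0 < x"
  shows "(\<lambda>k. (4 * real k + 3) powr (-x) - (4 * real k + 5) powr (-x)) sums (1 - dirichlet_beta x)"
proof -
  have "(\<lambda>k. (-1) ^ (k + 1) * (2 * real (k + 1) + 1) powr (-x)) sums (dirichlet_beta x - 1)"
    using sums_split_initial_segment[OF dirichlet_beta_sums[OF assms], of 1] by simp
  from sums_minus[OF sums_group[OF this, of 2]] show ?thesis
    by (simp add: algebra_simps)
qed

lemma dirichlet_beta_1: "dirichlet_beta 1 = pi / 4"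
  unfolding dirichlet_beta_def pi_series by (simp add: powr_minus_divide ac_simps)

lemma dirichlet_beta_tendsto: "(dirichlet_beta \<longlongrightarrow> 1) at_top"
proof (rule tendsto_sandwich)
  have bounds: "1 - 3 powr (-x) \<le> dirichlet_beta x" "dirichlet_beta x \<le> 1" if "0 < x" for x :: real
    \<comment> \<open>The two-term partial sum gives the lower bound, the one-term partial sum the
      upper bound.\<close>
    using dirichlet_beta_in_Leibniz_interval[OF that, of 1] dirichlet_beta_in_Leibniz_interval[OF that, of 0]
    by (auto simp: numeral_2_eq_2)
  show "eventually (\<lambda>x. 1 - 3 powr (-x) \<le> dirichlet_beta x) at_top"
    using eventually_gt_at_top[of 0] by eventually_elim (rule bounds)
  show "eventually (\<lambda>x. dirichlet_beta x \<le> 1) at_top"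
    using eventually_gt_at_top[of 0] by eventually_elim (rule bounds)
  show "((\<lambda>x::real. 1 - 3 powr (-x)) \<longlongrightarrow> 1) at_top" by real_asymp
qed simp

lemma ln_3_ge_1: "1 \<le> ln (3::real)"
  using exp_le by (simp add: ln_ge_iff)

lemma ln_4k_plus_3_ge: "ln 3 \<le> ln (4 * real k + 3)"
  by simp

lemma strict_mono_on_dirichlet_beta: "strict_mono_on {1..} dirichlet_beta"
proof -
  have decr: "strict_antimono_on {1..} (\<lambda>x. (4 * real k + 3) powr (-x) - (4 * real k + 5) powr (-x))" for k
    using ln_3_ge_1 ln_4k_plus_3_ge[of k] by (intro strict_antimono_on_powr_minus_diff) linarith+
  have "strict_antimono_on {1..} (\<lambda>x. \<Sum>k. (4 * real k + 3) powr (-x) - (4 * real k + 5) powr (-x))"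
  proof (rule strict_antimono_on_suminf)
    fix x y :: real and k assume "x \<in> {1..}" "y \<in> {1..}" "x < y"
    with monotone_onD[OF decr[of k] this]
    show "(4 * real k + 3) powr (-y) - (4 * real k + 5) powr (-y) \<le> (4 * real k + 3) powr (-x) - (4 * real k + 5) powr (-x)"
      by linarith
    show "(4 * real 0 + 3) powr (-y) - (4 * real 0 + 5) powr (-y) < (4 * real 0 + 3) powr (-x) - (4 * real 0 + 5) powr (-x)"
      using monotone_onD[OF decr[of 0] \<open>x \<in> {1..}\<close> \<open>y \<in> {1..}\<close> \<open>x < y\<close>] .
  qed (rule sums_summable[OF one_minus_dirichlet_beta_sums], simp)
  then have "strict_antimono_on {1..} (\<lambda>x. 1 - dirichlet_beta x)"
    using one_minus_dirichlet_beta_sums by (auto simp: monotone_on_def sums_iff)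
  then show ?thesis by (auto simp: monotone_on_def)
qed

lemma dirichlet_beta_image: "dirichlet_beta ` {1..} = {pi / 4..<1}"
proof -
  let ?g = "\<lambda>k x. (4 * real k + 3) powr (-x) - (4 * real k + 5) powr (-x)"
  have "continuous_on {1..} (\<lambda>x. \<Sum>k. ?g k x)"
  proof (rule continuous_on_suminf_antimono)
    fix k and x :: real assume x: "1 \<le> x"
    then show "0 \<le> ?g k x" by (auto intro!: powr_mono2')
    have "strict_antimono_on {1..} (?g k)"
      using ln_3_ge_1 ln_4k_plus_3_ge[of k] by (intro strict_antimono_on_powr_minus_diff) linarith+
    from monotone_onD[OF this, of 1 x] show "?g k x \<le> ?g k 1"
      using x by (cases "x = 1") auto
  next
    show "summable (\<lambda>k. ?g k 1)" by (rule sums_summable[OF one_minus_dirichlet_beta_sums]) simp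
  qed (auto intro!: continuous_intros)
  then have "continuous_on {1..} (\<lambda>x. 1 - (\<Sum>k. ?g k x))"
    by (intro continuous_intros)
  moreover have "1 - (\<Sum>k. ?g k x) = dirichlet_beta x" if "x \<in> {1..}" for x
    using one_minus_dirichlet_beta_sums[of x] that by (simp add: sums_iff)
  ultimately have "continuous_on {1..} dirichlet_beta"
    by (metis (no_types, lifting) continuous_on_cong)
  from image_Ici_strict_mono[OF strict_mono_on_dirichlet_beta this dirichlet_beta_tendsto]
  show ?thesis by (simp add: dirichlet_beta_1)
qed

lemma concave_on_dirichlet_beta: "concave_on {2 / ln 3..} dirichlet_beta"
proof -
  let ?g = "\<lambda>k x. (4 * real k + 3) powr (-x) - (4 * real k + 5) powr (-x)"
  have pos: "0 < 2 / ln (3::real)" by simp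
  have "convex_on {2 / ln 3..} (\<lambda>x. \<Sum>k. ?g k x)"
  proof (rule convex_on_suminf)
    fix k
    \<comment> \<open>The threshold is dictated by the smallest base 3; larger bases satisfy the
      convexity condition a fortiori.\<close>
    have "2 / ln 3 * ln 3 \<le> 2 / ln 3 * ln (4 * real k + 3)"
      using pos by (intro mult_left_mono ln_4k_plus_3_ge less_imp_le)
    then show "convex_on {2 / ln 3..} (?g k)"
      by (intro convex_on_powr_minus_diff) auto
  next
    fix x :: real assume "x \<in> {2 / ln 3..}"
    then have "0 < x" using pos by (meson atLeast_iff less_le_trans)
    then show "summable (\<lambda>k. ?g k x)" by (rule sums_summable[OF one_minus_dirichlet_beta_sums])
  qed simp
  moreover have "(\<Sum>k. ?g k x) = 1 - dirichlet_beta x" if "x \<in> {2 / ln 3..}" for x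
  proof -
    have "0 < x" using pos that by (meson atLeast_iff less_le_trans)
    then show ?thesis using one_minus_dirichlet_beta_sums[of x] by (simp add: sums_iff)
  qed
  ultimately have "convex_on {2 / ln 3..} (\<lambda>x. 1 - dirichlet_beta x)"
    by (rule convex_on_eq)
  then have "concave_on {2 / ln 3..} (\<lambda>x. 1 - (1 - dirichlet_beta x))"
    by (intro concave_on_diff) (auto simp: concave_on_const)
  then show ?thesis by simp
qed

section \<open>The functions phi3 to phi6\<close>

text \<open>In terms of \<open>m = 2 * k + 5\<close> this is \<open>m - (5 - 4 * s) / m\<close>,
  with \<open>s\<close> equal to 1 or -1 according to whether \<open>m\<close> is 1 or 3 modulo 4.
  At \<open>m = 1\<close> and \<open>m = 3\<close> the same formula gives \<open>1 - 1\<close> and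
  \<open>3 - 9 / 3\<close>; shifting the index by two skips these zeros and keeps the sign
  \<open>(-1) ^ k\<close>.\<close>

definition phi3_coeff :: "nat \<Rightarrow> real" where
  "phi3_coeff k = 2 * real k + 5 - (5 - 4 * (-1) ^ k) / (2 * real k + 5)"

text \<open>The numerator is at most 9, while \<open>m^2\<close> is at least 25.\<close>

lemma phi3_coeff_pos: "0 < phi3_coeff k"
proof -
  have "5 - 4 * (-1) ^ k \<le> (9::real)" by (cases "even k") auto
  also have "\<dots> < (2 * real k + 5) * (2 * real k + 5)"
    by (rule less_le_trans[of _ "5 * 5"]) (simp, intro mult_mono, auto)
  finally show ?thesis by (simp add: phi3_coeff_def divide_less_eq)
qed

lemma phi3_sums:
  assumes "2 < x"
  shows "(\<lambda>k. phi3_coeff k * (2 * real k + 5) powr (-x)) sums (- phi3 x)"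
proof -
  let ?t = "\<lambda>k. (2 * real k + 1 - (5 - 4 * (-1) ^ k) / (2 * real k + 1)) * (2 * real k + 1) powr (-x)"
  have "?t = (\<lambda>k. - (5 * (2 * real k + 1) powr (-(x + 1)) - (2 * real k + 1) powr (-(x - 1))
      - 4 * ((-1) ^ k * (2 * real k + 1) powr (-(x + 1)))))"
  proof
    fix k
    have "(2 * real k + 1) powr (-(x - 1)) = (2 * real k + 1) * (2 * real k + 1) powr (-x)"
      using powr_add[of "2 * real k + 1" 1 "-x"] by simp
    moreover have "(2 * real k + 1) powr (-(x + 1)) = (2 * real k + 1) powr (-x) / (2 * real k + 1)"
      by (simp add: powr_diff)
    ultimately show "?t k = - (5 * (2 * real k + 1) powr (-(x + 1)) - (2 * real k + 1) powr (-(x - 1))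
      - 4 * ((-1) ^ k * (2 * real k + 1) powr (-(x + 1))))"
      by (simp only: ring_distribs) (simp add: algebra_simps diff_divide_distrib)
  qed
  moreover have "\<dots> sums (- phi3 x)"
    unfolding phi3_def using assms
    by (intro sums_minus sums_diff sums_mult dirichlet_lambda_sums dirichlet_beta_sums) auto
  ultimately have "?t sums (- phi3 x)" by simp
  \<comment> \<open>The two terms split off are zero, so the sum is unchanged.\<close>
  from sums_split_initial_segment[OF this, of 2] show ?thesis
    by (simp add: numeral_2_eq_2 phi3_coeff_def algebra_simps)
qed

lemma phi3_suminf: "2 < x \<Longrightarrow> phi3 x = - (\<Sum>k. phi3_coeff k * (2 * real k + 5) powr (-x))"
  using phi3_sums[of x] by (simp add: sums_iff)

lemmas summable_phi3 = phi3_sums[THEN sums_summable]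

lemma strict_mono_on_phi3: "strict_mono_on {2<..} phi3"
proof -
  have "strict_antimono_on {2<..} (\<lambda>x. \<Sum>k. phi3_coeff k * (2 * real k + 5) powr (-x))"
  proof (rule strict_antimono_on_suminf)
    fix x y :: real and k assume "x < y"
    then have *: "phi3_coeff k * (2 * real k + 5) powr (-y) < phi3_coeff k * (2 * real k + 5) powr (-x)" for k
      using phi3_coeff_pos by (intro mult_strict_left_mono powr_minus_strict_antimono) auto
    show "phi3_coeff k * (2 * real k + 5) powr (-y) \<le> phi3_coeff k * (2 * real k + 5) powr (-x)"
      using *[of k] by simp
    show "phi3_coeff 0 * (2 * real 0 + 5) powr (-y) < phi3_coeff 0 * (2 * real 0 + 5) powr (-x)"
      by (rule *)
  qed (rule summable_phi3, simp)
  then show ?thesis by (auto simp: monotone_on_def phi3_suminf)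
qed

lemma concave_on_phi3: "concave_on {2<..} phi3"
proof -
  have "convex_on {2<..} (\<lambda>x. \<Sum>k. phi3_coeff k * (2 * real k + 5) powr (-x))"
  proof (rule convex_on_suminf)
    show "convex_on {2<..} (\<lambda>x. phi3_coeff k * (2 * real k + 5) powr (-x))" for k
      using phi3_coeff_pos[of k] by (intro convex_on_cmul convex_on_powr_minus) auto
  qed (simp, rule summable_phi3, simp)
  then have "convex_on {2<..} (\<lambda>x. - phi3 x)"
    by (rule convex_on_eq) (simp add: phi3_suminf)
  then show ?thesis by (simp add: concave_on_def)
qed

lemma continuous_on_phi3: "continuous_on {2<..} phi3"
proof (rule continuous_on_Ioi_if_Ici)
  fix b :: real assume b: "2 < b"
  have "continuous_on {b..} (\<lambda>x. \<Sum>k. phi3_coeff k * (2 * real k + 5) powr (-x))"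
  proof (rule continuous_on_suminf_antimono)
    fix k and x :: real assume "b \<le> x"
    show "0 \<le> phi3_coeff k * (2 * real k + 5) powr (-x)" using phi3_coeff_pos[of k] by simp
    show "phi3_coeff k * (2 * real k + 5) powr (-x) \<le> phi3_coeff k * (2 * real k + 5) powr (-b)"
      using phi3_coeff_pos[of k] \<open>b \<le> x\<close> by (intro mult_left_mono powr_minus_antimono) auto
  qed (use b in \<open>auto intro!: continuous_intros summable_phi3\<close>)
  then have "continuous_on {b..} (\<lambda>x. - (\<Sum>k. phi3_coeff k * (2 * real k + 5) powr (-x)))"
    by (rule continuous_on_minus)
  then show "continuous_on {b..} phi3"
    by (rule continuous_on_eq) (use b in \<open>simp add: phi3_suminf\<close>)
qed

lemma phi3_decay:
  assumes "3 \<le> x"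
  shows "0 < - phi3 x" "- phi3 x \<le> 5 powr (3 - x) * - phi3 3"
proof -
  show "0 < - phi3 x"
    using suminf_pos[OF summable_phi3[of x]] phi3_coeff_pos assms by (simp add: phi3_suminf)
  show "- phi3 x \<le> 5 powr (3 - x) * - phi3 3"
    using dirichlet_series_decay[of phi3_coeff 5 "\<lambda>k. 2 * real k + 5" 3 x] phi3_coeff_pos assms
      summable_phi3[of 3]
    by (simp add: phi3_suminf less_imp_le)
qed

section \<open>Linear multiples of \<open>phi3\<close> and their differences\<close>

lemma linear_times_phi3_tendsto: "((\<lambda>x. (x + c) * phi3 x) \<longlongrightarrow> 0) at_top"
proof (rule Lim_null_comparison)
  show "eventually (\<lambda>x. norm ((x + c) * phi3 x) \<le> (\<bar>x + c\<bar> * 5 powr (3 - x)) * - phi3 3) at_top"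
    using eventually_ge_at_top[of 3]
  proof eventually_elim
    case (elim x)
    then have "\<bar>phi3 x\<bar> \<le> 5 powr (3 - x) * - phi3 3" using phi3_decay[of x] by simp
    then have "\<bar>x + c\<bar> * \<bar>phi3 x\<bar> \<le> \<bar>x + c\<bar> * (5 powr (3 - x) * - phi3 3)"
      by (intro mult_left_mono) auto
    then show ?case by (simp add: abs_mult mult.assoc)
  qed
  have "((\<lambda>x. \<bar>x + c\<bar> * 5 powr (3 - x)) \<longlongrightarrow> 0) at_top" by real_asymp
  from tendsto_mult_right[OF this, of "- phi3 3"]
  show "((\<lambda>x. (\<bar>x + c\<bar> * 5 powr (3 - x)) * - phi3 3) \<longlongrightarrow> 0) at_top" by simp
qed

text \<open>The condition on \<open>(a + c) * ln 5\<close> is the critical-point condition for the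
  smallest base 5 and implies that of every larger base. For \<open>phi4\<close> it holds with
  equality at \<open>a = 3\<close>, which explains the shift by \<open>1 / ln 5\<close>.\<close>

lemma strict_mono_on_linear_times_phi3:
  assumes "2 < a" "0 < a + c" "1 \<le> (a + c) * ln 5"
  shows "strict_mono_on {a..} (\<lambda>x. (x + c) * phi3 x)"
proof -
  let ?g = "\<lambda>k x. phi3_coeff k * ((x + c) * (2 * real k + 5) powr (-x))"
  have eq: "(\<lambda>k. ?g k x) sums (- ((x + c) * phi3 x))" if "2 < x" for x
    using sums_mult[OF phi3_sums[OF that], of "x + c"] by (simp add: mult_ac)
  have decr: "strict_antimono_on {a..} (\<lambda>x. (x + c) * (2 * real k + 5) powr (-x))" for k
  proof (rule strict_antimono_on_linear_times_powr)
    have "(a + c) * ln 5 \<le> (a + c) * ln (2 * real k + 5)"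
      using assms by (intro mult_left_mono) auto
    then show "1 \<le> (a + c) * ln (2 * real k + 5)" using assms by linarith
  qed (use assms in auto)
  have "strict_antimono_on {a..} (\<lambda>x. \<Sum>k. ?g k x)"
  proof (rule strict_antimono_on_suminf)
    fix x y and k assume "x \<in> {a..}" "y \<in> {a..}" "x < y"
    then have *: "?g k y < ?g k x" for k
      using monotone_onD[OF decr[of k]] phi3_coeff_pos by (intro mult_strict_left_mono) auto
    show "?g k y \<le> ?g k x" using *[of k] by simp
    show "?g 0 y < ?g 0 x" by (rule *)
  qed (rule sums_summable[OF eq], use assms in simp)
  moreover have "(\<Sum>k. ?g k x) = - ((x + c) * phi3 x)" if "a \<le> x" for x
    using eq[of x] that assms by (simp add: sums_iff)
  ultimately show ?thesis by (auto simp: monotone_on_def)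
qed

lemma linear_times_phi3_image:
  assumes "2 < a" "0 < a + c" "1 \<le> (a + c) * ln 5"
  shows "(\<lambda>x. (x + c) * phi3 x) ` {a..} = {(a + c) * phi3 a..<0}"
proof -
  have "continuous_on {a..} phi3"
    by (rule continuous_on_subset[OF continuous_on_phi3]) (use assms in auto)
  then show ?thesis
    by (intro image_Ici_strict_mono strict_mono_on_linear_times_phi3 linear_times_phi3_tendsto assms continuous_intros)
qed

lemma phi3_image: "phi3 ` {3..} = {phi3 3..<0}"
proof (rule image_Ici_strict_mono)
  show "strict_mono_on {3..} phi3"
    using strict_mono_on_phi3 by (auto simp: monotone_on_def)
  show "continuous_on {3..} phi3"
    by (rule continuous_on_subset[OF continuous_on_phi3]) auto
  \<comment> \<open>\<open>phi3\<close> itself is the difference of two of its linear multiples,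
    both of which tend to 0.\<close>
  have "((\<lambda>x. (x + 1) * phi3 x - (x + 0) * phi3 x) \<longlongrightarrow> 0 - 0) at_top"
    by (intro tendsto_diff linear_times_phi3_tendsto)
  then show "(phi3 \<longlongrightarrow> 0) at_top" by (simp add: algebra_simps)
qed

lemma ln_5_ge_1: "1 \<le> ln (5::real)"
proof -
  have "ln (3::real) \<le> ln 5" by simp
  then show ?thesis using ln_3_ge_1 by linarith
qed

lemma phi4_altdef: "phi4 = (\<lambda>x. (x + (1 / ln 5 - 3)) * phi3 x)"
  by (simp add: fun_eq_iff phi4_def algebra_simps)

lemma phi5_altdef: "phi5 = (\<lambda>x. (x + 0) * phi3 x)"
  by (simp add: fun_eq_iff phi5_def)

lemma strict_mono_on_phi4: "strict_mono_on {3..} phi4"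
  unfolding phi4_altdef using ln_5_ge_1 by (intro strict_mono_on_linear_times_phi3) auto

lemma phi4_image: "phi4 ` {3..} = {phi3 3 / ln 5..<0}"
  unfolding phi4_altdef using ln_5_ge_1 by (subst linear_times_phi3_image) auto

lemma strict_mono_on_phi5: "strict_mono_on {3..} phi5"
  unfolding phi5_altdef using ln_5_ge_1 by (intro strict_mono_on_linear_times_phi3) auto

lemma phi5_image: "phi5 ` {3..} = {3 * phi3 3..<0}"
  unfolding phi5_altdef using ln_5_ge_1 by (subst linear_times_phi3_image) auto

lemma phi5_tendsto: "(phi5 \<longlongrightarrow> 0) at_top"
  unfolding phi5_altdef by (rule linear_times_phi3_tendsto)

text \<open>In \<open>phi5 (x + 2) - phi5 x\<close> the negative sign of the series for
  \<open>phi3\<close> swaps the two terms, so each summand has the form treated by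
  \<open>strict_antimono_on_diff_times_powr\<close>; its condition holds since
  \<open>3 * ln 5 \<ge> 2\<close>.\<close>

lemma strict_antimono_on_phi6: "strict_antimono_on {3..} phi6"
proof -
  let ?g = "\<lambda>k x. phi3_coeff k * (x * (2 * real k + 5) powr (-x) - (x + 2) * (2 * real k + 5) powr (-(x + 2)))"
  have eq: "(\<lambda>k. ?g k x) sums phi6 x" if "3 \<le> x" for x
    using sums_diff[OF sums_mult[OF phi3_sums, of x x] sums_mult[OF phi3_sums, of "x + 2" "x + 2"]] that
    by (simp add: phi6_def phi5_def algebra_simps)
  have decr: "strict_antimono_on {3..} (\<lambda>x. x * (2 * real k + 5) powr (-x) - (x + 2) * (2 * real k + 5) powr (-(x + 2)))" for k
  proof (rule strict_antimono_on_diff_times_powr)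
    have "ln 5 \<le> ln (2 * real k + 5)" by simp
    then show "2 \<le> 3 * ln (2 * real k + 5)" using ln_5_ge_1 by linarith
  qed auto
  have "strict_antimono_on {3..} (\<lambda>x. \<Sum>k. ?g k x)"
  proof (rule strict_antimono_on_suminf)
    fix x y and k assume xy: "x \<in> {3..}" "y \<in> {3..}" "x < (y::real)"
    have *: "?g k y < ?g k x" for k
      using monotone_onD[OF decr[of k] xy] phi3_coeff_pos by (intro mult_strict_left_mono) auto
    show "?g k y \<le> ?g k x" using *[of k] by simp
    show "?g 0 y < ?g 0 x" by (rule *)
  qed (rule sums_summable[OF eq], simp)
  moreover have "(\<Sum>k. ?g k x) = phi6 x" if "3 \<le> x" for x
    using eq[OF that] by (simp add: sums_iff)
  ultimately show ?thesis by (auto simp: monotone_on_def)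
qed

lemma phi6_image: "phi6 ` {3..} = {0<..phi6 3}"
proof -
  have "continuous_on {3..} phi3" "continuous_on {3..} (\<lambda>x. phi3 (x + 2))"
    by (rule continuous_on_compose2[OF continuous_on_phi3]; auto intro!: continuous_intros)+
  then have "continuous_on {3..} phi6"
    unfolding phi6_def[abs_def] phi5_def by (intro continuous_intros)
  moreover have "((\<lambda>x. phi5 (x + 2)) \<longlongrightarrow> 0) at_top"
    by (rule filterlim_compose[OF phi5_tendsto]) real_asymp
  then have "(phi6 \<longlongrightarrow> 0) at_top"
    unfolding phi6_def[abs_def] using tendsto_diff[OF _ phi5_tendsto] by fastforce
  moreover have "strict_mono_on {3..} (\<lambda>x. - phi6 x)"
    using strict_antimono_on_phi6 by (auto simp: monotone_on_def)
  ultimately have "(\<lambda>x. - phi6 x) ` {3..} = {- phi6 3..<-0}"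
    by (intro image_Ici_strict_mono tendsto_minus continuous_on_minus)
  then have "uminus ` (\<lambda>x. - phi6 x) ` {3..} = uminus ` {- phi6 3..<0}" by simp
  then show ?thesis by (simp add: image_image)
qed

section \<open>Values of lambda at 2 and 4\<close>

text \<open>Multiply Euler's product for the sine at \<open>x\<close> and at
  \<open>\<i> * x\<close>: the factors combine by
  \<open>(1 - x^2 / k^2) * (1 + x^2 / k^2) = 1 - x^4 / k^4\<close>, and the sine of an imaginary
  argument is \<open>\<i>\<close> times a hyperbolic sine.\<close>

lemma sin_sinh_product:
  fixes x :: real
  assumes "x \<noteq> 0"
  shows "(\<lambda>n. \<Prod>k=1..n. 1 - x ^ 4 / real k ^ 4) \<longlonglongrightarrow> sin (pi * x) * sinh (pi * x) / (pi * x)\<^sup>2"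
proof -
  have eq: "complex_of_real pi * of_real x * (\<Prod>k=1..n. 1 - (of_real x)^2 / of_nat k^2) *
      (of_real pi * (\<i> * of_real x) * (\<Prod>k=1..n. 1 - (\<i> * of_real x)^2 / of_nat k^2))
      = \<i> * of_real ((pi * x)\<^sup>2 * (\<Prod>k=1..n. 1 - x ^ 4 / real k ^ 4))" for n
  proof -
    have "(\<Prod>k=1..n. 1 - (complex_of_real x)^2 / of_nat k^2) * (\<Prod>k=1..n. 1 - (\<i> * of_real x)^2 / of_nat k^2)
        = (\<Prod>k=1..n. 1 - (of_real x)^4 / of_nat k ^ 4)"
      unfolding prod.distrib[symmetric]
      by (intro prod.cong) (auto simp: field_simps power_mult_distrib simp flip: power_add)
    then show ?thesis
      by (simp add: power2_eq_square mult_ac)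
  qed
  have "sin (\<i> * complex_of_real (pi * x)) = \<i> * of_real (sinh (pi * x))"
    by (simp add: sin_i_times sinh_def scaleR_conv_of_real exp_minus field_simps flip: exp_of_real)
  then have "sin (of_real pi * complex_of_real x) * sin (of_real pi * (\<i> * complex_of_real x))
      = \<i> * of_real (sin (pi * x) * sinh (pi * x))"
    by (simp add: mult_ac sin_of_real flip: of_real_mult)
  with tendsto_mult[OF sin_product_formula_complex sin_product_formula_complex, of "of_real x" "\<i> * of_real x"]
  have "(\<lambda>n. \<i> * complex_of_real ((pi * x)\<^sup>2 * (\<Prod>k=1..n. 1 - x ^ 4 / real k ^ 4)))
        \<longlonglongrightarrow> \<i> * of_real (sin (pi * x) * sinh (pi * x))"
    unfolding eq by simp
  from tendsto_mult[OF tendsto_const[of "-\<i>"] this]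
  have "(\<lambda>n. complex_of_real ((pi * x)\<^sup>2 * (\<Prod>k=1..n. 1 - x ^ 4 / real k ^ 4)))
        \<longlonglongrightarrow> of_real (sin (pi * x) * sinh (pi * x))"
    by (simp flip: mult.assoc)
  then have "(\<lambda>n. (pi * x)\<^sup>2 * (\<Prod>k=1..n. 1 - x ^ 4 / real k ^ 4))
        \<longlonglongrightarrow> sin (pi * x) * sinh (pi * x)"
    by (simp only: tendsto_of_real_iff)
  from tendsto_divide[OF this tendsto_const[of "(pi * x)\<^sup>2"]] show ?thesis
    using assms by simp
qed

lemma one_minus_sum_le_prod:
  fixes a :: "'a \<Rightarrow> real"
  assumes "\<And>k. k \<in> A \<Longrightarrow> a k \<in> {0..1}"
  shows "1 - sum a A \<le> (\<Prod>k\<in>A. 1 - a k)"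
  using assms
proof (induction A rule: infinite_finite_induct)
  case (insert k A)
  then have "0 \<le> a k" "a k \<le> 1" "0 \<le> sum a A" "1 - sum a A \<le> (\<Prod>k\<in>A. 1 - a k)"
    by (auto intro: sum_nonneg)
  then have "(1 - a k) * (1 - sum a A) \<le> (1 - a k) * (\<Prod>k\<in>A. 1 - a k)" "0 \<le> a k * sum a A"
    by (auto intro: mult_left_mono)
  then show ?case using insert.hyps by (simp add: algebra_simps)
qed auto

text \<open>The product \<open>S x\<close> lies between \<open>1 - Z * x^4\<close> and
  \<open>exp (- Z * x^4)\<close>, so \<open>(1 - S x) / x^4\<close> tends to \<open>Z\<close> at 0.
  The expansion of \<open>sin y * sinh y / y^2\<close> begins with \<open>1 - y^4 / 90\<close>, and
  uniqueness of limits identifies \<open>Z\<close>.\<close>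

lemma inverse_fourth_powers_sums: "(\<lambda>k. 1 / real (k + 1) ^ 4) sums (pi ^ 4 / 90)"
proof -
  have "summable (\<lambda>n. inverse (real n ^ 4))"
    by (rule inverse_power_summable) simp
  then have summ: "summable (\<lambda>k. 1 / real (k + 1) ^ 4)"
    using summable_ignore_initial_segment[of "\<lambda>n. inverse (real n ^ 4)" 1]
    by (simp add: field_simps)
  define Z where "Z = (\<Sum>k. 1 / real (k + 1) ^ 4)"
  have partial: "(\<lambda>n. \<Sum>k=1..n. 1 / real k ^ 4) \<longlonglongrightarrow> Z"
    using summable_LIMSEQ[OF summ] unfolding Z_def
    by (simp add: sum.atLeast1_atMost_eq)
  define S where "S x = sin (pi * x) * sinh (pi * x) / (pi * x)\<^sup>2" for x
  have bounds: "1 - Z * x ^ 4 \<le> S x" "S x \<le> exp (- Z * x ^ 4)" if "0 < x" "x < 1" for x :: real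
  proof -
    have a: "0 \<le> x ^ 4 / real k ^ 4" "x ^ 4 / real k ^ 4 \<le> 1" if "k \<ge> 1" for k
    proof -
      have "x ^ 4 \<le> real k ^ 4" using \<open>0 < x\<close> \<open>x < 1\<close> that by (intro power_mono) auto
      then show "x ^ 4 / real k ^ 4 \<le> 1" using that by simp
    qed auto
    have "(\<lambda>n. \<Prod>k=1..n. 1 - x ^ 4 / real k ^ 4) \<longlonglongrightarrow> S x"
      unfolding S_def using that by (intro sin_sinh_product) auto
    moreover have s: "(\<lambda>n. x ^ 4 * (\<Sum>k=1..n. 1 / real k ^ 4)) \<longlonglongrightarrow> x ^ 4 * Z"
      by (intro tendsto_intros partial)
    moreover have "1 - x ^ 4 * (\<Sum>k=1..n. 1 / real k ^ 4) \<le> (\<Prod>k=1..n. 1 - x ^ 4 / real k ^ 4)" for n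
      using one_minus_sum_le_prod[of "{1..n}" "\<lambda>k. x ^ 4 / real k ^ 4"] a
      by (simp add: sum_distrib_left)
    ultimately show "1 - Z * x ^ 4 \<le> S x"
      by (intro LIMSEQ_le[of "\<lambda>n. 1 - x ^ 4 * (\<Sum>k=1..n. 1 / real k ^ 4)" "1 - Z * x ^ 4"])
         (use tendsto_diff[OF tendsto_const s] in \<open>auto simp: mult.commute\<close>)
    have "(\<Prod>k=1..n. 1 - x ^ 4 / real k ^ 4) \<le> exp (- (x ^ 4 * (\<Sum>k=1..n. 1 / real k ^ 4)))" for n
    proof -
      have "(\<Prod>k=1..n. 1 - x ^ 4 / real k ^ 4) \<le> (\<Prod>k=1..n. exp (- (x ^ 4 / real k ^ 4)))"
      proof (intro prod_mono conjI)
        fix k assume "k \<in> {1..n}"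
        then show "0 \<le> 1 - x ^ 4 / real k ^ 4" using a[of k] by auto
        show "1 - x ^ 4 / real k ^ 4 \<le> exp (- (x ^ 4 / real k ^ 4))"
          using exp_ge_add_one_self[of "- (x ^ 4 / real k ^ 4)"] by simp
      qed
      also have "\<dots> = exp (- (x ^ 4 * (\<Sum>k=1..n. 1 / real k ^ 4)))"
        by (simp add: exp_sum sum_distrib_left flip: sum_negf)
      finally show ?thesis .
    qed
    moreover have "(\<lambda>n. exp (- (x ^ 4 * (\<Sum>k=1..n. 1 / real k ^ 4)))) \<longlonglongrightarrow> exp (- (x ^ 4 * Z))"
      by (intro tendsto_intros s)
    ultimately have "S x \<le> exp (- (x ^ 4 * Z))"
      using \<open>(\<lambda>n. \<Prod>k=1..n. 1 - x ^ 4 / real k ^ 4) \<longlonglongrightarrow> S x\<close> by (intro LIMSEQ_le) auto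
    then show "S x \<le> exp (- Z * x ^ 4)" by (simp add: mult.commute)
  qed
  have "((\<lambda>x. (1 - S x) / x ^ 4) \<longlongrightarrow> Z) (at_right 0)"
  proof (rule tendsto_sandwich)
    have ev: "eventually (\<lambda>x. x \<in> {0<..<1::real}) (at_right 0)"
      by (rule eventually_at_right_real) simp
    show "eventually (\<lambda>x. (1 - exp (- Z * x ^ 4)) / x ^ 4 \<le> (1 - S x) / x ^ 4) (at_right 0)"
      using ev by eventually_elim (use bounds(2) in \<open>auto intro!: divide_right_mono\<close>)
    show "eventually (\<lambda>x. (1 - S x) / x ^ 4 \<le> Z) (at_right 0)"
      using ev
    proof eventually_elim
      case (elim x)
      then show ?case using bounds(1)[of x] by (simp add: divide_le_eq)
    qed
    show "((\<lambda>x. (1 - exp (- Z * x ^ 4)) / x ^ 4) \<longlongrightarrow> Z) (at_right 0)"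
      by real_asymp
  qed auto
  moreover have "((\<lambda>x. (1 - S x) / x ^ 4) \<longlongrightarrow> pi ^ 4 / 90) (at_right 0)"
  proof -
    \<comment> \<open>The hyperbolic sine is spelled out by exponentials so that the asymptotic
      expansion can be computed automatically.\<close>
    have "((\<lambda>y::real. (1 - sin y * ((exp y - exp (-y)) / 2) / y\<^sup>2) / y ^ 4) \<longlongrightarrow> 1 / 90) (at_right 0)"
      by real_asymp
    moreover have "filterlim (\<lambda>x. pi * x) (at_right 0) (at_right 0)" by real_asymp
    ultimately have "((\<lambda>x. (1 - sin (pi * x) * ((exp (pi * x) - exp (-(pi * x))) / 2) / (pi * x)\<^sup>2) / (pi * x) ^ 4)
        \<longlongrightarrow> 1 / 90) (at_right 0)"
      by (rule filterlim_compose)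
    from tendsto_mult_left[OF this, of "pi ^ 4"] show ?thesis
      by (simp add: S_def sinh_field_def power_mult_distrib)
  qed
  ultimately have "Z = pi ^ 4 / 90"
    by (rule tendsto_unique[rotated]) simp
  then show ?thesis using summ by (simp add: Z_def sums_iff)
qed

lemma dirichlet_lambda_sums_nat:
  assumes "2 \<le> n"
  shows "(\<lambda>k. 1 / (2 * real k + 1) ^ n) sums dirichlet_lambda (real n)"
  using dirichlet_lambda_sums[of "real n"] assms by (simp add: powr_minus_divide powr_realpow)

text \<open>The even numbers contribute \<open>1 / 2 ^ n\<close> of the whole zeta sum, and what
  remains is the sum over odd numbers.\<close>

lemma dirichlet_lambda_eq_zeta:
  assumes "2 \<le> n" and Z: "(\<lambda>k. 1 / real (k + 1) ^ n) sums Z"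
  shows "dirichlet_lambda (real n) = (1 - 1 / 2 ^ n) * Z"
proof -
  have "(\<lambda>k. 1 / (2 * real k + 1) ^ n + 1 / (2 * real k + 2) ^ n) sums Z"
    using sums_group[OF Z, of 2] by (simp add: algebra_simps)
  moreover have "(\<lambda>k. 1 / (2 * real k + 2) ^ n) sums (1 / 2 ^ n * Z)"
  proof -
    have "1 / 2 ^ n * (1 / real (k + 1) ^ n) = 1 / (2 * real k + 2) ^ n" for k
      by (simp flip: power_mult_distrib add: algebra_simps)
    with sums_mult[OF Z, of "1 / 2 ^ n"] show ?thesis by simp
  qed
  ultimately have "(\<lambda>k. 1 / (2 * real k + 1) ^ n) sums (Z - 1 / 2 ^ n * Z)"
    using sums_diff by fastforce
  with dirichlet_lambda_sums_nat[OF assms(1)] show ?thesis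
    by (simp add: sums_unique2 left_diff_distrib)
qed

lemma dirichlet_lambda_2: "dirichlet_lambda 2 = pi\<^sup>2 / 8"
  using dirichlet_lambda_eq_zeta[of 2 "pi\<^sup>2 / 6"] inverse_squares_sums by simp

lemma dirichlet_lambda_4: "dirichlet_lambda 4 = pi ^ 4 / 96"
  using dirichlet_lambda_eq_zeta[of 4 "pi ^ 4 / 90"] inverse_fourth_powers_sums by simp

section \<open>Numerical bounds\<close>

text \<open>Each \<open>1 / m^3\<close> lies between two telescoping differences, built from
  \<open>1 / (4 * ((m - 1)^2 + c))\<close> with \<open>c = 1\<close> below and \<open>c = 0\<close>
  above. Bounding the tail on both sides makes 70 terms sufficient despite the slow
  convergence.\<close>

lemma dirichlet_lambda_3_tail:
  fixes N :: nat
  assumes "0 < N"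
  shows "dirichlet_lambda 3 - (\<Sum>k<N. 1 / (2 * real k + 1) ^ 3) \<in> {1 / (4 * ((2 * real N)\<^sup>2 + 1))..1 / (4 * (2 * real N)\<^sup>2)}"
proof -
  let ?t = "\<lambda>k. 1 / (2 * real (k + N) + 1) ^ 3"
  have t: "?t sums (dirichlet_lambda 3 - (\<Sum>k<N. 1 / (2 * real k + 1) ^ 3))"
    using sums_split_initial_segment[OF dirichlet_lambda_sums_nat[of 3], of N] by simp
  have tele: "(\<lambda>k. 1 / (4 * ((2 * real (k + N))\<^sup>2 + c)) - 1 / (4 * ((2 * real (k + N) + 2)\<^sup>2 + c)))
      sums (1 / (4 * ((2 * real N)\<^sup>2 + c)))" (is "?u c sums _") for c :: real
  proof -
    have "(\<lambda>k. 1 / (4 * ((2 * real (k + N))\<^sup>2 + c))) \<longlonglongrightarrow> 0" by real_asymp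
    from telescope_sums'[OF this] show ?thesis by (simp add: algebra_simps)
  qed
  have "?t k \<le> ?u 0 k" "?u 1 k \<le> ?t k" for k
  proof -
    define m where "m = 2 * real (k + N) + 1"
    have "3 \<le> m" using assms by (simp add: m_def)
    then have m: "0 < m" "0 < m - 1" by auto
    have "?u 0 k = m / ((m - 1)\<^sup>2 * (m + 1)\<^sup>2)"
      using m by (simp add: m_def divide_simps) algebra
    also have "\<dots> = m / (m\<^sup>2 - 1)\<^sup>2" by (simp add: algebra_simps power2_eq_square)
    also have "\<dots> \<ge> m / m ^ 4"
    proof (rule divide_left_mono)
      have "(m\<^sup>2 - 1)\<^sup>2 \<le> (m\<^sup>2)\<^sup>2" using \<open>3 \<le> m\<close> by (intro power_mono) (auto simp: one_le_power)
      then show "(m\<^sup>2 - 1)\<^sup>2 \<le> m ^ 4" by simp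
      have "1 < m\<^sup>2" using \<open>3 \<le> m\<close> by (intro one_less_power) auto
      then show "0 < m ^ 4 * (m\<^sup>2 - 1)\<^sup>2" using m by (intro mult_pos_pos zero_less_power) auto
    qed (use m in simp)
    also have "m / m ^ 4 = 1 / m ^ 3" using m by (simp add: power_eq_if)
    finally show "?t k \<le> ?u 0 k" by (simp add: m_def)
    have pos: "0 < (m - 1)\<^sup>2 + 1" "0 < (m + 1)\<^sup>2 + 1" by (auto intro: add_nonneg_pos)
    have "?u 1 k = 1 / (4 * ((m - 1)\<^sup>2 + 1)) - 1 / (4 * ((m + 1)\<^sup>2 + 1))"
      by (simp add: m_def)
    also have "\<dots> = m / (((m - 1)\<^sup>2 + 1) * ((m + 1)\<^sup>2 + 1))"
      using pos by (simp add: divide_simps) algebra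
    \<comment> \<open>Sophie Germain's identity; it puts the difference for \<open>c = 1\<close>
      just below \<open>1 / m^3\<close>.\<close>
    also have "((m - 1)\<^sup>2 + 1) * ((m + 1)\<^sup>2 + 1) = m ^ 4 + 4" by algebra
    also have "m / (m ^ 4 + 4) \<le> m / m ^ 4"
      using m by (intro divide_left_mono mult_pos_pos add_pos_pos zero_less_power) auto
    also have "m / m ^ 4 = 1 / m ^ 3" using m by (simp add: power_eq_if)
    finally show "?u 1 k \<le> ?t k" by (simp add: m_def)
  qed
  note le = this
  have "1 / (4 * ((2 * real N)\<^sup>2 + 1)) \<le> dirichlet_lambda 3 - (\<Sum>k<N. 1 / (2 * real k + 1) ^ 3)"
    "dirichlet_lambda 3 - (\<Sum>k<N. 1 / (2 * real k + 1) ^ 3) \<le> 1 / (4 * ((2 * real N)\<^sup>2 + 0))"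
    by (rule sums_le[OF le(2) tele t], rule sums_le[OF le(1) t tele])
  then show ?thesis by simp
qed

text \<open>Compared with the cubic tail, every term gains at least a factor \<open>1 / N^2\<close>,
  because \<open>m^n \<ge> m^5 \<ge> N^2 * m^3\<close>.\<close>

lemma dirichlet_lambda_tail:
  fixes N :: nat
  assumes "0 < N" "5 \<le> n"
  shows "dirichlet_lambda (real n) - (\<Sum>k<N. 1 / (2 * real k + 1) ^ n) \<in> {0..1 / (16 * real N ^ 4)}"
proof -
  let ?S = "\<lambda>n. \<Sum>k<N. 1 / (2 * real k + 1) ^ n"
  have t: "(\<lambda>k. 1 / (2 * real (k + N) + 1) ^ n) sums (dirichlet_lambda (real n) - ?S n)" if "2 \<le> n" for n
    using sums_split_initial_segment[OF dirichlet_lambda_sums_nat[OF that], of N] .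
  have t3: "(\<lambda>k. 1 / (2 * real (k + N) + 1) ^ 3) sums (dirichlet_lambda 3 - ?S 3)"
    using t[of 3] by simp
  have "1 / (2 * real (k + N) + 1) ^ n \<le> 1 / real N ^ 2 * (1 / (2 * real (k + N) + 1) ^ 3)" for k
  proof -
    have "real N ^ 2 * (2 * real (k + N) + 1) ^ 3 \<le> (2 * real (k + N) + 1) ^ 2 * (2 * real (k + N) + 1) ^ 3"
      by (intro mult_right_mono power_mono) auto
    also have "\<dots> = (2 * real (k + N) + 1) ^ 5" by (simp flip: power_add)
    also have "\<dots> \<le> (2 * real (k + N) + 1) ^ n" using assms by (intro power_increasing) auto
    finally show ?thesis using assms by (simp add: frac_le)
  qed
  then have "dirichlet_lambda (real n) - ?S n \<le> 1 / real N ^ 2 * (dirichlet_lambda 3 - ?S 3)"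
    using assms by (intro sums_le[OF _ t sums_mult[OF t3]]) simp_all
  also have "\<dots> \<le> 1 / real N ^ 2 * (1 / (4 * (2 * real N)\<^sup>2))"
    using dirichlet_lambda_3_tail[OF assms(1)] by (intro mult_left_mono) auto
  also have "\<dots> = 1 / (16 * real N ^ 4)" by (simp add: power_mult_distrib flip: power_add)
  finally show ?thesis using sums_le[OF _ sums_zero t[of n]] assms by simp
qed

lemma dirichlet_beta_tail:
  assumes "0 < n"
  shows "dirichlet_beta (real n) - (\<Sum>k<2 * N. (-1) ^ k / (2 * real k + 1) ^ n) \<in> {0..1 / (4 * real N + 1) ^ n}"
  using dirichlet_beta_in_Leibniz_interval[of "real n" N] assms
  by (simp add: powr_minus_divide powr_realpow algebra_simps)

text \<open>Rounding every summand to a multiple of \<open>1 / D\<close> keeps the numerators small.\<close>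

lemma rounded_sum:
  fixes e :: "nat \<Rightarrow> real" and m :: "nat \<Rightarrow> nat"
  assumes "\<And>k. \<bar>e k\<bar> \<le> 1" "\<And>k. 0 < m k" 
  shows "\<bar>real D * (\<Sum>k<N. e k / real (m k)) - (\<Sum>k<N. e k * real (D div m k))\<bar> \<le> real N"
proof -
  have "\<bar>e k * (real D / real (m k) - real (D div m k))\<bar> \<le> 1" for k
  proof -
    have "real D / real (m k) - real (D div m k) = real (D mod m k) / real (m k)"
      using of_nat_of_nat_div_aux[of D "m k", where 'a = real] by linarith
    moreover have "D mod m k \<le> m k" using assms(2)[of k] by (intro less_imp_le mod_less_divisor)
    ultimately have "0 \<le> real D / real (m k) - real (D div m k)" "real D / real (m k) - real (D div m k) \<le> 1"
      using assms(2)[of k] by simp_all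
    then show ?thesis using assms(1)[of k] by (auto simp: abs_mult intro!: mult_le_one)
  qed
  then have "(\<Sum>k<N. \<bar>e k * (real D / real (m k) - real (D div m k))\<bar>) \<le> real N"
    using sum_bounded_above[of "{..<N}" "\<lambda>k. \<bar>e k * (real D / real (m k) - real (D div m k))\<bar>" 1] by simp
  moreover have "real D * (\<Sum>k<N. e k / real (m k)) - (\<Sum>k<N. e k * real (D div m k))
      = (\<Sum>k<N. e k * (real D / real (m k) - real (D div m k)))"
    by (simp add: sum_distrib_left sum_subtractf right_diff_distrib mult_ac)
  moreover have "\<bar>\<Sum>k<N. e k * (real D / real (m k) - real (D div m k))\<bar>
      \<le> (\<Sum>k<N. \<bar>e k * (real D / real (m k) - real (D div m k))\<bar>)" by (rule sum_abs)
  ultimately show ?thesis by linarith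
qed

text \<open>With 70 terms in units of \<open>10 ^ -12\<close> the rounding error is at most
  \<open>7 * 10 ^ -11\<close>, well below the accuracy needed.\<close>

lemma rounded_dirichlet_lambda_sum:
  assumes "(\<Sum>k<70. 10 ^ 12 div (2 * k + 1) ^ n) = (c::nat)"
  shows "\<bar>10 ^ 12 * (\<Sum>k<70. 1 / (2 * real k + 1) ^ n) - real c\<bar> \<le> 70"
  using rounded_sum[of "\<lambda>_. 1" "\<lambda>k. (2 * k + 1) ^ n" "10 ^ 12" 70] unfolding assms[symmetric]
  by (simp add: add.commute)

lemma rounded_dirichlet_beta_sum:
  assumes "(\<Sum>k<70. (-1) ^ k * real (10 ^ 12 div (2 * k + 1) ^ n)) = c"
  shows "\<bar>10 ^ 12 * (\<Sum>k<2 * 35. (-1) ^ k / (2 * real k + 1) ^ n) - c\<bar> \<le> 70"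
  using rounded_sum[of "\<lambda>k. (-1) ^ k" "\<lambda>k. (2 * k + 1) ^ n" "10 ^ 12" 70] unfolding assms[symmetric]
  by (simp add: add.commute)

lemma dirichlet_lambda_3_bounds: "dirichlet_lambda 3 \<in> {1.0517997901..1.0517997910}"
proof -
  have "(\<Sum>k<70. 10 ^ 12 div (2 * k + 1) ^ 3) = (1051787035782::nat)"
    by (simp add: lessThan_nat_numeral)
  from rounded_dirichlet_lambda_sum[OF this] dirichlet_lambda_3_tail[of 70] show ?thesis
    by (auto simp: abs_le_iff)
qed

lemma dirichlet_lambda_5_bounds: "dirichlet_lambda 5 \<in> {1.0045237623..1.0045237652}"
proof -
  have "(\<Sum>k<70. 10 ^ 12 div (2 * k + 1) ^ 5) = (1004523762435::nat)"
    by (simp add: lessThan_nat_numeral)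
  from rounded_dirichlet_lambda_sum[OF this] dirichlet_lambda_tail[of 70 5] show ?thesis
    by (auto simp: abs_le_iff)
qed

lemma dirichlet_lambda_6_bounds: "dirichlet_lambda 6 \<in> {1.0014470765..1.0014470794}"
proof -
  have "(\<Sum>k<70. 10 ^ 12 div (2 * k + 1) ^ 6) = (1001447076610::nat)"
    by (simp add: lessThan_nat_numeral)
  from rounded_dirichlet_lambda_sum[OF this] dirichlet_lambda_tail[of 70 6] show ?thesis
    by (auto simp: abs_le_iff)
qed

lemma dirichlet_beta_4_bounds: "dirichlet_beta 4 \<in> {0.9889445503..0.9889445531}"
proof -
  have "(\<Sum>k<70. (-1) ^ k * real (10 ^ 12 div (2 * k + 1) ^ 4)) = 988944550442"
    by (simp add: lessThan_nat_numeral)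
  from rounded_dirichlet_beta_sum[OF this] dirichlet_beta_tail[of 4 35] show ?thesis
    by (auto simp: abs_le_iff)
qed

lemma dirichlet_beta_5_bounds: "dirichlet_beta 5 \<in> {0.9961578279..0.9961578282}"
proof -
  have "(\<Sum>k<70. (-1) ^ k * real (10 ^ 12 div (2 * k + 1) ^ 5)) = 996157828067"
    by (simp add: lessThan_nat_numeral)
  from rounded_dirichlet_beta_sum[OF this] dirichlet_beta_tail[of 5 35] show ?thesis
    by (auto simp: abs_le_iff)
qed

lemma dirichlet_beta_6_bounds: "dirichlet_beta 6 \<in> {0.9986852221..0.9986852223}"
proof -
  have "(\<Sum>k<70. (-1) ^ k * real (10 ^ 12 div (2 * k + 1) ^ 6)) = 998685222222"
    by (simp add: lessThan_nat_numeral)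
  from rounded_dirichlet_beta_sum[OF this] dirichlet_beta_tail[of 6 35] show ?thesis
    by (auto simp: abs_le_iff)
qed

section \<open>Enclosures of powers of pi, of logarithms and of the constants\<close>

lemma pi_squared_bounds: "pi\<^sup>2 \<in> {9.8696044010..9.8696044011}"
proof -
  have "3.141592653588\<^sup>2 \<le> pi\<^sup>2" "pi\<^sup>2 \<le> 3.1415926535899\<^sup>2"
    using pi_approx pi_gt_zero by (auto intro!: power_mono)
  then show ?thesis by (simp add: power2_eq_square)
qed

lemma pi_fourth_bounds: "pi ^ 4 \<in> {97.409091030..97.409091037}"
proof -
  have "9.8696044010 * 9.8696044010 \<le> pi\<^sup>2 * pi\<^sup>2" "pi\<^sup>2 * pi\<^sup>2 \<le> 9.8696044011 * 9.8696044011"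
    using pi_squared_bounds by (intro mult_mono; simp)+
  moreover have "pi\<^sup>2 * pi\<^sup>2 = pi ^ 4" by (simp flip: power_add)
  ultimately show ?thesis by simp
qed

lemma ln_3_bounds: "ln 3 \<in> {1.09861228..1.09861229::real}"
  using ln_approx_bounds[of 3 13] by (simp add: lessThan_nat_numeral power_divide)

lemma ln_5_bounds: "ln 5 \<in> {1.609437..1.609439::real}"
proof -
  \<comment> \<open>The argument \<open>5/3\<close> is closer to 1 than 5, so few terms of the
    logarithm series suffice; \<open>ln 3\<close> is added afterwards.\<close>
  have "ln (5/3) \<in> {0.5108255..0.5108257::real}"
    using ln_approx_bounds[of "5/3" 6] by (simp add: lessThan_nat_numeral power_divide)
  moreover have "ln (5/3) = ln 5 - ln (3::real)" by (simp add: ln_div)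
  ultimately show ?thesis using ln_3_bounds by simp
qed

lemma ln_pi_squared_bounds: "ln (pi\<^sup>2 / 8) \<in> {0.2100179..0.21001831}"
proof -
  \<comment> \<open>This fraction and \<open>2687 / 2178\<close> below enclose
    \<open>pi^2 / 8\<close> tightly from the two sides.\<close>
  have "0.2100179 \<le> ln (1457 / 1181 :: real)"
    using ln_approx_bounds[of "1457 / 1181" 4] by (simp add: lessThan_nat_numeral power_divide)
  moreover have "ln (2687 / 2178) \<le> (0.21001831 :: real)"
    using ln_approx_bounds[of "2687 / 2178" 4] by (simp add: lessThan_nat_numeral power_divide)
  moreover have "ln (1457 / 1181) \<le> ln (pi\<^sup>2 / 8)" "ln (pi\<^sup>2 / 8) \<le> ln (2687 / 2178)"
    using pi_squared_bounds by (intro ln_mono; simp add: field_simps)+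
  ultimately show ?thesis
    unfolding atLeastAtMost_iff by (intro conjI; linarith)
qed

lemma C1_bounds: "C1 \<in> {0.191166..<0.191167}"
  using ln_pi_squared_bounds ln_3_bounds by (simp add: C1_def divide_simps)

lemma phi3_3: "phi3 3 = 5 * pi ^ 4 / 96 - 4 * dirichlet_beta 4 - pi\<^sup>2 / 8"
  by (simp add: phi3_def dirichlet_lambda_4 dirichlet_lambda_2)

lemma phi3_3_bounds: "phi3 3 \<in> {-0.11608861..-0.11608859}"
  using pi_squared_bounds pi_fourth_bounds dirichlet_beta_4_bounds by (simp add: phi3_3)

lemma phi3_4_bounds: "phi3 4 \<in> {-0.0138123..-0.0138122}"
  using dirichlet_lambda_3_bounds dirichlet_lambda_5_bounds dirichlet_beta_5_bounds by (simp add: phi3_def)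

lemma phi3_5_bounds: "phi3 5 \<in> {-0.00218354..-0.00218352}"
  using pi_fourth_bounds dirichlet_lambda_6_bounds dirichlet_beta_6_bounds
  by (simp add: phi3_def dirichlet_lambda_4)

section \<open>The sequence \<open>bseq\<close> as \<open>phi3\<close> at even integers\<close>

lemma bseq_altdef: "bseq n = phi3 (2 * real n)"
  by (simp add: bseq_def phi3_def)

lemma times_bseq_altdef: "real n * bseq n = phi5 (2 * real n) / 2"
  by (simp add: bseq_altdef phi5_def)

text \<open>A step of 1 in \<open>n\<close> is a step of 2 in the argument of \<open>phi5\<close>,
  hence the increment 2 in \<open>phi6\<close>.\<close>

lemma diff_times_bseq: "real (n + 1) * bseq (n + 1) - real n * bseq n = phi6 (2 * real n) / 2"
  unfolding times_bseq_altdef by (simp add: phi6_def algebra_simps)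

lemma times_bseq_tendsto: "(\<lambda>n. real n * bseq n) \<longlonglongrightarrow> 0"
proof -
  have "filterlim (\<lambda>n. 2 * real n) at_top sequentially" by real_asymp
  from tendsto_divide[OF filterlim_compose[OF phi5_tendsto this] tendsto_const[of 2]] show ?thesis
    by (simp add: times_bseq_altdef)
qed

lemma phi2_2: "phi2 c 2 = C2 c"
  by (simp add: phi2_def C2_def dirichlet_lambda_2)

lemma phi6_3: "phi6 3 = mu4"
  by (simp add: phi6_def mu4_def mu3_def mu1_def phi5_def)

theorem lemma2p1:
  shows
    "(\<comment> \<open>(1)\<close>
      strict_antimono_on {1<..} dirichlet_lambda \<and> convex_on {1<..} dirichlet_lambda \<and>
      strict_antimono_on {1<..} phi1 \<and> convex_on {1<..} phi1 \<and>
      dirichlet_lambda ` {1<..} = {1<..} \<and> phi1 ` {1<..} = {0<..} \<and>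
      (\<forall>c\<in>{C1..}. strict_mono_on {2..} (phi2 c) \<and> phi2 c ` {2..} = {C2 c..<1} \<and>
         C2 c > 8 / pi\<^sup>2) \<and>
      C1 \<in> {0.191166..<0.191167} \<and> 8 / pi\<^sup>2 \<in> {0.810569..<0.810570})
     \<and>
     (\<comment> \<open>(2)\<close>
      strict_mono_on {1..} dirichlet_beta \<and> dirichlet_beta ` {1..} = {pi / 4..<1} \<and>
      concave_on {2 / ln 3..} dirichlet_beta)
     \<and>
     (\<comment> \<open>(3)\<close>
      strict_mono_on {3..} phi3 \<and> concave_on {3..} phi3 \<and> phi3 ` {3..} = {mu1..<0} \<and>
      strict_mono_on {3..} phi4 \<and> phi4 ` {3..} = {mu2..<0} \<and>
      strict_mono_on {3..} phi5 \<and> phi5 ` {3..} = {mu3..<0} \<and>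
      strict_antimono_on {3..} phi6 \<and> phi6 ` {3..} = {0<..mu4} \<and>
      mu1 = 5 * pi ^ 4 / 96 - 4 * dirichlet_beta 4 - pi\<^sup>2 / 8 \<and>
      mu1 \<in> {-0.116089<..-0.116088} \<and> mu2 \<in> {-0.072130<..-0.072129} \<and>
      mu3 \<in> {-0.348266<..-0.348265} \<and> mu4 \<in> {0.337348..<0.337349})
     \<and>
     (\<comment> \<open>(4)\<close>
      strict_mono_on {1..} (\<lambda>n. bseq (n + 1)) \<and>
      strict_mono_on {1..} (\<lambda>n. real (n + 1) * bseq (n + 1)) \<and>
      strict_antimono_on {1..} (\<lambda>n. real (n + 2) * bseq (n + 2) - real (n + 1) * bseq (n + 1)) \<and>
      (\<lambda>n. real n * bseq n) \<longlonglongrightarrow> 0 \<and>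
      (\<lambda>n. real (n + 1) * bseq (n + 1) - real n * bseq n) \<longlonglongrightarrow> 0 \<and>
      2 * bseq 2 \<in> {-0.027625<..-0.027624} \<and>
      (\<forall>n\<ge>2.
         2 * bseq 2 \<le> real n * bseq n \<and>
         real n * bseq n < real (n + 1) * bseq (n + 1) \<and>
         real (n + 1) * bseq (n + 1) \<le> min 0 (real n * bseq n + 3 * bseq 3 - 2 * bseq 2) \<and>
         (2 * bseq 2 = real n * bseq n \<longleftrightarrow> n = 2) \<and>
         (real (n + 1) * bseq (n + 1) = min 0 (real n * bseq n + 3 * bseq 3 - 2 * bseq 2) \<longleftrightarrow> n = 2)))"
proof -
  \<comment> \<open>\<open>C1\<close> is positive, so the Chebyshev argument for \<open>phi2\<close>
    covers all these \<open>c\<close>.\<close>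
  have c_pos: "0 < c" if "c \<in> {C1..}" for c
    using that C1_bounds by auto
  have phi2: "strict_mono_on {2..} (phi2 c)" "phi2 c ` {2..} = {C2 c..<1}" "C2 c > 8 / pi\<^sup>2"
    if "c \<in> {C1..}" for c
  proof -
    note c = c_pos[OF that]
    show "strict_mono_on {2..} (phi2 c)"
      using strict_mono_on_phi2[OF c] by (auto simp: monotone_on_def)
    show "phi2 c ` {2..} = {C2 c..<1}"
      using phi2_image[OF c, of 2] by (simp add: phi2_2)
    show "C2 c > 8 / pi\<^sup>2"
      using dirichlet_lambda_gt_1[of "2 + c"] c by (simp add: C2_def divide_strict_right_mono)
  qed
  have pi_numeric: "8 / pi\<^sup>2 \<in> {0.810569..<0.810570}"
    using pi_squared_bounds by (simp add: divide_simps)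
  have phi3: "strict_mono_on {3..} phi3"
    using strict_mono_on_phi3 by (auto simp: monotone_on_def)
  have phi3_concave: "concave_on {3..} phi3"
    using concave_on_phi3 unfolding concave_on_def by (rule convex_on_subset) auto
  have mu1_eq: "mu1 = 5 * pi ^ 4 / 96 - 4 * dirichlet_beta 4 - pi\<^sup>2 / 8"
    by (simp add: mu1_def phi3_3)
  have images: "phi3 ` {3..} = {mu1..<0}" "phi4 ` {3..} = {mu2..<0}" "phi5 ` {3..} = {mu3..<0}"
      "phi6 ` {3..} = {0<..mu4}"
    by (simp_all add: phi3_image phi4_image phi5_image phi6_image mu1_def mu2_def mu3_def flip: phi6_3)
  have mu1_numeric: "mu1 \<in> {-0.116089<..-0.116088}"
    using phi3_3_bounds by (simp add: mu1_def)
  have mu3_numeric: "mu3 \<in> {-0.348266<..-0.348265}"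
    using phi3_3_bounds by (simp add: mu3_def mu1_def)
  have mu2_numeric: "mu2 \<in> {-0.072130<..-0.072129}"
    using phi3_3_bounds ln_5_bounds by (simp add: mu2_def mu1_def divide_simps)
  have mu4_numeric: "mu4 \<in> {0.337348..<0.337349}"
    using phi3_3_bounds phi3_5_bounds by (simp add: mu4_def mu3_def mu1_def phi5_def)
  have phi5_less: "phi5 x < phi5 y" if "3 \<le> x" "x < y" for x y
    using strict_mono_on_phi5 that by (simp add: monotone_on_def)
  have phi6_less: "phi6 y < phi6 x" if "3 \<le> x" "x < y" for x y
    using strict_antimono_on_phi6 that by (simp add: monotone_on_def)
  have b2_numeric: "2 * bseq 2 \<in> {-0.027625<..-0.027624}"
    using phi3_4_bounds by (simp add: bseq_altdef)
  have b_mono: "strict_mono_on {1..} (\<lambda>n. bseq (n + 1))"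
    using phi3 by (auto simp: monotone_on_def bseq_altdef)
  have nb_mono: "strict_mono_on {1..} (\<lambda>n. real (n + 1) * bseq (n + 1))"
    unfolding times_bseq_altdef by (auto intro!: monotone_onI phi5_less divide_strict_right_mono)
  have diff_antimono: "strict_antimono_on {1..} (\<lambda>n. real (n + 2) * bseq (n + 2) - real (n + 1) * bseq (n + 1))"
  proof (rule monotone_onI)
    fix m n :: nat assume "m \<in> {1..}" "n \<in> {1..}" "m < n"
    then show "real (m + 2) * bseq (m + 2) - real (m + 1) * bseq (m + 1)
        > real (n + 2) * bseq (n + 2) - real (n + 1) * bseq (n + 1)"
      using diff_times_bseq[of "m + 1"] diff_times_bseq[of "n + 1"]
        phi6_less[of "2 * real (m + 1)" "2 * real (n + 1)"] by simp
  qed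
  have diff_tendsto: "(\<lambda>n. real (n + 1) * bseq (n + 1) - real n * bseq n) \<longlonglongrightarrow> 0"
    using tendsto_diff[OF LIMSEQ_ignore_initial_segment[OF times_bseq_tendsto, of 1] times_bseq_tendsto] by simp
  have chain: "2 * bseq 2 \<le> real n * bseq n \<and> real n * bseq n < real (n + 1) * bseq (n + 1) \<and>
      real (n + 1) * bseq (n + 1) \<le> min 0 (real n * bseq n + 3 * bseq 3 - 2 * bseq 2) \<and>
      (2 * bseq 2 = real n * bseq n \<longleftrightarrow> n = 2) \<and>
      (real (n + 1) * bseq (n + 1) = min 0 (real n * bseq n + 3 * bseq 3 - 2 * bseq 2) \<longleftrightarrow> n = 2)"
    if n: "2 \<le> n" for n
  proof -
    have lt: "real n * bseq n < real (n + 1) * bseq (n + 1)"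
      using phi5_less[of "2 * real n" "2 * real (n + 1)"] n unfolding times_bseq_altdef by simp
    have neg: "real (n + 1) * bseq (n + 1) < 0"
      unfolding bseq_altdef using phi3_decay(1)[of "2 * real (n + 1)"] n by (intro mult_pos_neg) auto
    \<comment> \<open>The right-hand side of the last inequality contains the increment at
      \<open>n = 2\<close>, the largest one since \<open>phi6\<close> decreases.\<close>
    have base: "3 * bseq 3 - 2 * bseq 2 = phi6 4 / 2"
      using diff_times_bseq[of 2] by simp
    show ?thesis
    \<comment> \<open>For \<open>n = 2\<close> the second argument of \<open>min\<close> collapses
      to \<open>3 * bseq 3\<close>, which is negative, so equality holds. For larger
      \<open>n\<close> strict monotonicity of \<open>phi5\<close> and \<open>phi6\<close> makes both
      inequalities strict.\<close>
    proof (cases "n = 2")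
      case True
      then show ?thesis using lt neg by simp
    next
      case False
      then have "2 * bseq 2 < real n * bseq n"
        using phi5_less[of 4 "2 * real n"] n times_bseq_altdef[of 2] times_bseq_altdef[of n] by simp
      moreover have "real (n + 1) * bseq (n + 1) < real n * bseq n + 3 * bseq 3 - 2 * bseq 2"
        using phi6_less[of 4 "2 * real n"] n False diff_times_bseq[of n] base by simp
      with neg have "real (n + 1) * bseq (n + 1) < min 0 (real n * bseq n + 3 * bseq 3 - 2 * bseq 2)"
        by (simp only: min_less_iff_conj)
      ultimately show ?thesis using lt False by (metis less_le)
    qed
  qed
  then have chain: "\<forall>n\<ge>2. 2 * bseq 2 \<le> real n * bseq n \<and> real n * bseq n < real (n + 1) * bseq (n + 1) \<and>
      real (n + 1) * bseq (n + 1) \<le> min 0 (real n * bseq n + 3 * bseq 3 - 2 * bseq 2) \<and>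
      (2 * bseq 2 = real n * bseq n \<longleftrightarrow> n = 2) \<and>
      (real (n + 1) * bseq (n + 1) = min 0 (real n * bseq n + 3 * bseq 3 - 2 * bseq 2) \<longleftrightarrow> n = 2)"
    by blast
  have lambda_image: "dirichlet_lambda ` {1<..} = {1<..}"
    by (rule image_Ioi_strict_antimono[OF strict_antimono_on_dirichlet_lambda continuous_on_dirichlet_lambda
        dirichlet_lambda_tendsto dirichlet_lambda_unbounded])
  show ?thesis
    by (intro conjI ballI;
      (rule strict_antimono_on_dirichlet_lambda convex_on_dirichlet_lambda strict_antimono_on_phi1
        convex_on_phi1 lambda_image phi1_image phi2 C1_bounds pi_numeric
        strict_mono_on_dirichlet_beta dirichlet_beta_image concave_on_dirichlet_beta
        phi3 phi3_concave images strict_mono_on_phi4 strict_mono_on_phi5 strict_antimono_on_phi6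
        mu1_eq mu1_numeric mu2_numeric mu3_numeric mu4_numeric
        b_mono nb_mono diff_antimono times_bseq_tendsto diff_tendsto b2_numeric chain; assumption))
qed

end
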